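(* Let $G=P_1P_2\cdots P_r$ be a finite non-cyclic nilpotent group of order $n=p_1^{\lambda_1}p_2^{\lambda_2}\cdots p_r^{\lambda_r}$ with $r\ge 2$, where $p_1<p_2<\cdots<p_r$ are primes, each $\lambda_i\geq 1$, and $P_i$ is the Sylow $p_i$-subgroup of $G$. Suppose that each Sylow subgroup $P_i$ is cyclic except $P_k$ for some $k\in\{1,\dots,r\}$. If $P_k$ is not a generalized quaternion group, then the set $Q=P_1\cdots P_{k-1}P_{k+1}\cdots P_r$ is the only minimum cut-set of $\mathcal{P}_E(G)$, and hence $\kappa(\mathcal{P}_E(G))=\frac{n}{p_k^{\lambda_k}}$. If $P_k$ is a generalized quaternion group $Q_{2^\alpha}$ (so that $k=1$, $p_1=2$ and $\alpha=\lambda_1$), then the set $Q'=Z(Q_{2^\alpha})P_2\cdots P_r$ is the only minimum cut-set of $\mathcal{P}_E(G)$, and hence $\kappa(\mathcal{P}_E(G))=\frac{n}{2^{\lambda_1-1}}$.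
   Context: For a finite group $G$, the enhanced power graph $\mathcal{P}_E(G)$ is the simple undirected graph with vertex set $G$ in which two distinct vertices $x,y$ are adjacent if and only if $x,y\in\langle z\rangle$ for some $z\in G$. A (vertex) cut-set of a connected graph $\Gamma$ is a set $X$ of vertices such that the subgraph $\Gamma\setminus X$ obtained by removing $X$ is either disconnected or has only one vertex; a minimum cut-set is one of smallest cardinality, and that cardinality is the vertex connectivity $\kappa(\Gamma)$. A finite nilpotent group is the (internal) direct product of its Sylow subgroups. $Q_{2^\alpha}$ denotes the generalized quaternion group of order $2^\alpha$ ($\alpha\ge 3$), and $Z(Q_{2^\alpha})$ its center. *)

theory Defs
  imports Complex_Main "HOL-Algebra.Algebra" "Graph_Theory.Graph_Theory"
begin

section \<open>Groups\<close>

text \<open>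
  The lower central series, indexed from 0: \<open>\<gamma>\<^sub>0 = G\<close> and \<open>\<gamma>\<^sub>n\<^sub>+\<^sub>1 = [\<gamma>\<^sub>n, G]\<close>, with the same
  commutator convention as \<^const>\<open>derived\<close>.
\<close>

primrec lower_central_series :: "('a, 'b) monoid_scheme \<Rightarrow> nat \<Rightarrow> 'a set" where
  "lower_central_series G 0 = carrier G"
| "lower_central_series G (Suc n) =
     generate G (\<Union>x \<in> lower_central_series G n. \<Union>y \<in> carrier G.
       {x \<otimes>\<^bsub>G\<^esub> y \<otimes>\<^bsub>G\<^esub> inv\<^bsub>G\<^esub> x \<otimes>\<^bsub>G\<^esub> inv\<^bsub>G\<^esub> y})"

definition nilpotent_group :: "('a, 'b) monoid_scheme \<Rightarrow> bool" where
  "nilpotent_group G \<longleftrightarrow> group G \<and> (\<exists>n. lower_central_series G n = {\<one>\<^bsub>G\<^esub>})"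

definition sylow_subgroup :: "('a, 'b) monoid_scheme \<Rightarrow> nat \<Rightarrow> 'a set \<Rightarrow> bool" where
  "sylow_subgroup G p H \<longleftrightarrow> subgroup H G \<and> card H = p ^ multiplicity p (order G)"

definition group_center :: "('a, 'b) monoid_scheme \<Rightarrow> 'a set" where
  "group_center G = {z \<in> carrier G. \<forall>g \<in> carrier G. z \<otimes>\<^bsub>G\<^esub> g = g \<otimes>\<^bsub>G\<^esub> z}"

text \<open>
  \<open>G\<close> is a copy of
  \<open>Q = \<langle>x, y | x^(2^(a-1)) = 1, y^2 = x^(2^(a-2)), y^(-1) x y = x^(-1)\<rangle>\<close>.
  The group so presented has order exactly \<open>2^a\<close>, so a group generated by elements satisfying
  these relations is a quotient of it, and is isomorphic to it as soon as its order is \<open>2^a\<close>.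
\<close>

definition generalized_quaternion :: "('a, 'b) monoid_scheme \<Rightarrow> nat \<Rightarrow> bool" where
  "generalized_quaternion G a \<longleftrightarrow> group G \<and> a \<ge> 3 \<and> order G = 2 ^ a \<and>
     (\<exists>x \<in> carrier G. \<exists>y \<in> carrier G.
        generate G {x, y} = carrier G \<and>
        x [^]\<^bsub>G\<^esub> (2 ^ (a - 1) :: nat) = \<one>\<^bsub>G\<^esub> \<and>
        y [^]\<^bsub>G\<^esub> (2 :: nat) = x [^]\<^bsub>G\<^esub> (2 ^ (a - 2) :: nat) \<and>
        inv\<^bsub>G\<^esub> y \<otimes>\<^bsub>G\<^esub> x \<otimes>\<^bsub>G\<^esub> y = inv\<^bsub>G\<^esub> x)"

definition set_mult_list :: "('a, 'b) monoid_scheme \<Rightarrow> 'a set list \<Rightarrow> 'a set" where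
  "set_mult_list G Hs = foldr (\<lambda>H K. H <#>\<^bsub>G\<^esub> K) Hs {\<one>\<^bsub>G\<^esub>}"


section \<open>Vertex connectivity\<close>

text \<open>
  A simple undirected graph is a finite, symmetric, loop-free digraph without parallel arcs
  (locale \<^locale>\<open>pair_graph\<close>). In the library the graph without vertices is not connected, so
  the whole vertex set also counts as a cut-set. This affects neither minimum cut-sets nor the
  vertex connectivity: removing all vertices but one already gives a smaller cut-set.
\<close>

definition vertex_cut_set :: "('a, 'b) pre_digraph \<Rightarrow> 'a set \<Rightarrow> bool" where
  "vertex_cut_set \<Gamma> S \<longleftrightarrow> Digraph_Component.connected \<Gamma> \<and> S \<subseteq> verts \<Gamma> \<and>
     (\<not> Digraph_Component.connected (\<Gamma> \<restriction> (verts \<Gamma> - S)) \<or> card (verts \<Gamma> - S) = 1)"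

definition minimum_cut_set :: "('a, 'b) pre_digraph \<Rightarrow> 'a set \<Rightarrow> bool" where
  "minimum_cut_set \<Gamma> S \<longleftrightarrow>
     vertex_cut_set \<Gamma> S \<and> (\<forall>Y. vertex_cut_set \<Gamma> Y \<longrightarrow> card S \<le> card Y)"

definition vertex_connectivity :: "('a, 'b) pre_digraph \<Rightarrow> nat" where
  "vertex_connectivity \<Gamma> = (LEAST c. \<exists>S. vertex_cut_set \<Gamma> S \<and> card S = c)"


section \<open>The enhanced power graph\<close>

definition enhanced_power_graph :: "('a, 'b) monoid_scheme \<Rightarrow> 'a pair_pre_digraph" where
  "enhanced_power_graph G =
     \<lparr> pverts = carrier G,
       parcs = {(x, y). x \<in> carrier G \<and> y \<in> carrier G \<and> x \<noteq> y \<and>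
         (\<exists>z \<in> carrier G. x \<in> generate G {z} \<and> y \<in> generate G {z})} \<rparr>"

lemma pair_graph_enhanced_power_graph:
  assumes "finite (carrier G)"
  shows "pair_graph (enhanced_power_graph G)"
proof -
  have "parcs (enhanced_power_graph G) \<subseteq> carrier G \<times> carrier G"
    by (auto simp: enhanced_power_graph_def)
  then have "finite (parcs (enhanced_power_graph G))"
    using assms finite_subset by blast
  then show ?thesis
    using assms
    by unfold_locales
      (auto simp: enhanced_power_graph_def symmetric_def arcs_ends_def arc_to_ends_def
        intro!: symI)
qed

end

theory Submission
  imports Defs "HOL-Number_Theory.Residues"
begin

text \<open>
  In a nilpotent group, elements of coprime order commute, so \<open>G\<close> is the internal direct product of
  \<open>A = P\<^sub>k\<close> and the product \<open>B\<close> of the other Sylow subgroups, and \<open>B\<close> is cyclic of order prime to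
  that of \<open>A\<close>. A cyclic subgroup of \<open>A \<times> B\<close> is a product of cyclic subgroups of \<open>A\<close> and of \<open>B\<close>.
  As \<open>B\<close> is cyclic, two elements of \<open>G\<close> lie in a common cyclic subgroup exactly when their
  \<open>A\<close>-components do: the enhanced power graph of \<open>G\<close> is that of \<open>A\<close> with each vertex replaced
  by a clique of size \<open>|B|\<close>.

  A vertex adjacent to all others must be removed before a graph can fall apart. Hence, if the
  removal of a nonempty set \<open>D\<close> of such vertices does disconnect the graph, then \<open>D\<close> lies in
  every other cut-set except possibly those that leave a single vertex, and these are larger
  than \<open>D\<close>: so \<open>D\<close> is the only minimum cut-set (\<open>unique_minimum_cut_set_dominating\<close>). It remains
  to find in the \<open>p\<close>-group \<open>A\<close> a set \<open>D\<close> of elements that share a cyclic subgroup with every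
  element, and a property of the elements outside \<open>D\<close> that is constant on cyclic subgroups but
  not on \<open>A\<close> (\<open>cyclic_separation\<close>).

  If \<open>A\<close> has two distinct subgroups of order \<open>p\<close>, take \<open>D = {1}\<close>: a nontrivial cyclic subgroup of
  \<open>A\<close> contains exactly one subgroup of order \<open>p\<close>, and which one it is does not change along an edge.
  If \<open>A\<close> is generalized quaternion, its centre \<open>D = {1, z}\<close> lies in every maximal cyclic subgroup;
  an element outside the cyclic subgroup \<open>\<langle>x\<rangle>\<close> of index two has square \<open>z\<close>, so its cyclic subgroup
  meets \<open>\<langle>x\<rangle>\<close> in \<open>D\<close> only, and membership in \<open>\<langle>x\<rangle>\<close> separates.

  That these two cases are exhaustive is the classical fact that a \<open>p\<close>-group with only one subgroup
  of order \<open>p\<close> is cyclic or generalized quaternion (\<open>cyclic_or_generalized_quaternion\<close>). It is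
  proved through a normal abelian subgroup \<open>M\<close> that is its own centralizer. Such an \<open>M\<close> is cyclic,
  \<open>M = \<langle>x\<rangle>\<close>. If \<open>u\<close> is outside \<open>M\<close> with \<open>u\<^sup>p\<close> in \<open>M\<close>, then some \<open>x\<^sup>i u\<close> has order \<open>p\<close>, although it
  lies outside \<open>M\<close> and hence outside the subgroup of order \<open>p\<close> of \<open>M\<close>, unless \<open>p = 2\<close>, \<open>u\<close> inverts \<open>x\<close>, and \<open>u\<^sup>2\<close> is the involution of
  \<open>M\<close>. Since inversion is not a square in the automorphism group of a cyclic group of order
  divisible by 4, every element outside \<open>M\<close> is such a \<open>u\<close>, so \<open>M\<close> has index two and the relations
  of a generalized quaternion group hold.
\<close>

section \<open>Cut-sets of dominating vertices\<close>

lemma (in wf_digraph) connected_induce_dominating: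
  assumes "u \<in> S" and "S \<subseteq> verts G"
    and "\<And>v. v \<in> S \<Longrightarrow> v \<noteq> u \<Longrightarrow> u \<rightarrow> v"
  shows "Digraph_Component.connected (G \<restriction> S)"
proof -
  let ?H = "mk_symmetric (G \<restriction> S)"
  interpret I: wf_digraph "G \<restriction> S" by (rule wellformed_induce_subgraph)
  interpret H: pair_wf_digraph ?H by (rule I.wellformed_mk_symmetric)
  have arc: "(u, v) \<in> parcs ?H" "(v, u) \<in> parcs ?H" if v: "v \<in> S" "v \<noteq> u" for v
  proof -
    obtain e where "e \<in> arcs G" "tail G e = u" "head G e = v"
      using assms(3)[OF v] by (auto simp: arcs_ends_conv)
    then show "(u, v) \<in> parcs ?H" "(v, u) \<in> parcs ?H"
      using v assms(1) by (auto simp: parcs_mk_symmetric)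
  qed
  have to: "u \<rightarrow>\<^sup>*\<^bsub>?H\<^esub> v \<and> v \<rightarrow>\<^sup>*\<^bsub>?H\<^esub> u" if "v \<in> S" for v
  proof (cases "v = u")
    case True
    then show ?thesis using assms(1) by (auto intro!: H.reachable_refl)
  next
    case False
    then show ?thesis using arc[OF that] by (auto intro!: H.reachable_adjI)
  qed
  have "x \<rightarrow>\<^sup>*\<^bsub>?H\<^esub> y" if "x \<in> S" "y \<in> S" for x y
    using to[OF that(1)] to[OF that(2)] H.reachable_trans by blast
  then show ?thesis
    using assms(1) by (auto simp: Digraph_Component.connected_def strongly_connected_def)
qed

text \<open>
  Connectedness refers to the underlying symmetric graph; since \<open>f u = f v\<close> is symmetric in
  \<open>u\<close> and \<open>v\<close>, it is enough to know it along the given orientation of each arc.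
\<close>

lemma not_connected_induce_invariant:
  assumes "\<And>u v. u \<rightarrow>\<^bsub>G\<^esub> v \<Longrightarrow> u \<in> S \<Longrightarrow> v \<in> S \<Longrightarrow> f u = f v"
    and "a \<in> S" "b \<in> S" "f a \<noteq> f b"
  shows "\<not> Digraph_Component.connected (G \<restriction> S)"
proof
  let ?H = "mk_symmetric (G \<restriction> S)"
  assume "Digraph_Component.connected (G \<restriction> S)"
  then have "a \<rightarrow>\<^sup>*\<^bsub>?H\<^esub> b"
    using assms(2,3) by (auto simp: Digraph_Component.connected_def strongly_connected_def)
  then have "(a, b) \<in> rtrancl_on S (parcs ?H)"
    by (simp add: reachable_def)
  then have "f a = f b"
  proof (induction rule: rtrancl_on_induct)
    case (step y z)
    then obtain e where "e \<in> arcs G" "tail G e \<in> S" "head G e \<in> S"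
      "(y, z) = (tail G e, head G e) \<or> (y, z) = (head G e, tail G e)"
      by (auto simp: parcs_mk_symmetric)
    then have "f y = f z"
      using assms(1)[of "tail G e" "head G e"] by (auto simp: arcs_ends_conv)
    with step show ?case by simp
  qed simp
  with assms(4) show False ..
qed

text \<open>
  The two vertices \<open>a\<close> and \<open>b\<close> witness that removing \<open>D\<close> disconnects the graph. They also give
  \<open>|D| \<le> |V| - 2\<close>, which rules out as competitors the cut-sets that leave a single vertex.
\<close>

theorem (in fin_digraph) unique_minimum_cut_set_dominating:
  assumes D: "D \<subseteq> verts G" "D \<noteq> {}"
    and dom: "\<And>u v. u \<in> D \<Longrightarrow> v \<in> verts G \<Longrightarrow> u \<noteq> v \<Longrightarrow> u \<rightarrow> v"
    and inv: "\<And>u v. u \<rightarrow> v \<Longrightarrow> u \<in> verts G - D \<Longrightarrow> v \<in> verts G - D \<Longrightarrow> f u = f v"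
    and ab: "a \<in> verts G - D" "b \<in> verts G - D" "f a \<noteq> f b"
  shows "minimum_cut_set G S \<longleftrightarrow> S = D"
    and "vertex_connectivity G = card D"
proof -
  obtain d where d: "d \<in> D" using D by blast
  have "Digraph_Component.connected (G \<restriction> verts G)"
    using connected_induce_dominating[of d "verts G"] d D dom by blast
  moreover have "mk_symmetric (G \<restriction> verts G) = mk_symmetric G"
    by (auto simp: mk_symmetric_def)
  ultimately have conn: "Digraph_Component.connected G"
    by (simp add: Digraph_Component.connected_def)
  have cutD: "vertex_cut_set G D"
    using not_connected_induce_invariant[of G "verts G - D" f a b] inv ab conn D
    unfolding vertex_cut_set_def by blast
  have small: "card D + 2 \<le> card (verts G)"
  proof -
    have "card {a, b} \<le> card (verts G - D)"
      using ab by (intro card_mono) auto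
    moreover have "card {a, b} = 2" using ab by (auto simp: card_2_iff)
    moreover have "card (verts G - D) = card (verts G) - card D"
      using D by (intro card_Diff_subset) (auto intro: finite_subset)
    moreover have "card D \<le> card (verts G)" using D by (intro card_mono) auto
    ultimately show ?thesis by linarith
  qed
  have less: "card D < card T" if T: "vertex_cut_set G T" "T \<noteq> D" for T
  proof -
    have Tv: "T \<subseteq> verts G" using T by (simp add: vertex_cut_set_def)
    have fT: "finite T" using Tv by (auto intro: finite_subset)
    show ?thesis
    proof (cases "D \<subseteq> T")
      case True
      then show ?thesis using T(2) fT by (intro psubset_card_mono) auto
    next
      case False
      then obtain u where u: "u \<in> D" "u \<notin> T" by blast
      have "Digraph_Component.connected (G \<restriction> (verts G - T))"
        using connected_induce_dominating[of u "verts G - T"] u D dom by blast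
      then have "card (verts G - T) = 1"
        using T(1) by (simp add: vertex_cut_set_def)
      moreover have "card (verts G - T) = card (verts G) - card T"
        using Tv fT by (intro card_Diff_subset) auto
      ultimately show ?thesis using small by linarith
    qed
  qed
  show "minimum_cut_set G S \<longleftrightarrow> S = D"
    using cutD less unfolding minimum_cut_set_def by (metis nle_le not_less)
  show "vertex_connectivity G = card D"
    unfolding vertex_connectivity_def
    using cutD less by (intro Least_equality) (metis nle_le not_less)+
qed

section \<open>Commutators in nilpotent groups\<close>

lemma (in group) conj_nat_pow:
  assumes "g \<in> carrier G" "h \<in> carrier G"
  shows "(g \<otimes> h \<otimes> inv g) [^] (n::nat) = g \<otimes> h [^] n \<otimes> inv g"
proof (induction n)
  case (Suc n)
  have "inv g \<otimes> (g \<otimes> z) = z" if "z \<in> carrier G" for z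
    using assms that by (simp flip: m_assoc)
  with Suc assms show ?case by (simp add: m_assoc)
qed (use assms in simp)

text \<open>
  Both \<open>c y = x y x\<^sup>-\<^sup>1\<close> and \<open>c x\<^sup>-\<^sup>1 = y x\<^sup>-\<^sup>1 y\<^sup>-\<^sup>1\<close> are conjugates, so \<open>(c y)\<^sup>b = 1\<close> and
  \<open>(c x\<^sup>-\<^sup>1)\<^sup>a = 1\<close>. As \<open>c\<close> commutes with \<open>x\<close> and \<open>y\<close>, this gives \<open>c\<^sup>b = 1 = c\<^sup>a\<close>.
\<close>

lemma (in group) commute_if_commutator_commutes:
  assumes xy: "x \<in> carrier G" "y \<in> carrier G"
    and c: "c = x \<otimes> y \<otimes> inv x \<otimes> inv y" "c \<otimes> x = x \<otimes> c" "c \<otimes> y = y \<otimes> c"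
    and pow: "x [^] (a::nat) = \<one>" "y [^] (b::nat) = \<one>" "coprime a b"
  shows "x \<otimes> y = y \<otimes> x"
proof -
  have cG: "c \<in> carrier G" using xy c(1) by simp
  have cy: "c \<otimes> y = x \<otimes> y \<otimes> inv x"
    using xy c(1) by (simp add: m_assoc)
  have "c [^] b = c [^] b \<otimes> y [^] b"
    using pow cG by simp
  also have "\<dots> = (c \<otimes> y) [^] b"
    using pow_mult_distrib[OF c(3) cG xy(2)] by simp
  also have "\<dots> = \<one>"
    unfolding cy using conj_nat_pow[OF xy] pow xy by simp
  finally have cb: "ord c dvd b" using cG by (simp add: pow_eq_id)
  have cx: "c \<otimes> inv x = inv x \<otimes> c"
    using c(2) cG xy by (metis inv_closed inv_solve_left inv_solve_right m_assoc m_closed)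
  have xc: "inv x \<otimes> c = y \<otimes> inv x \<otimes> inv y"
    using xy c(1) by (simp add: m_assoc flip: m_assoc[of "inv x" x])
  have "c [^] a = c [^] a \<otimes> (inv x) [^] a"
    using pow cG xy by (simp add: nat_pow_inv)
  also have "\<dots> = (c \<otimes> inv x) [^] a"
    using pow_mult_distrib[OF cx cG] xy by simp
  also have "\<dots> = \<one>"
    unfolding cx xc using conj_nat_pow[OF xy(2), of "inv x"] pow xy by (simp add: nat_pow_inv)
  finally have "ord c dvd a" using cG by (simp add: pow_eq_id)
  with cb pow(3) have "ord c = 1"
    using coprime_common_divisor_nat by blast
  then have "c = \<one>" using cG ord_eq_1 by blast
  with cy have "x \<otimes> y \<otimes> inv x = y" using xy by simp
  then show ?thesis using xy by (metis inv_solve_right m_closed)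
qed

lemma (in group) conj_commutator:
  assumes "g \<in> carrier G" "x \<in> carrier G" "y \<in> carrier G"
  shows "g \<otimes> (x \<otimes> y \<otimes> inv x \<otimes> inv y) \<otimes> inv g =
    (g \<otimes> x \<otimes> inv g) \<otimes> (g \<otimes> y \<otimes> inv g) \<otimes> inv (g \<otimes> x \<otimes> inv g) \<otimes> inv (g \<otimes> y \<otimes> inv g)"
proof -
  have "inv g \<otimes> (g \<otimes> z) = z" if "z \<in> carrier G" for z
    using assms that by (simp flip: m_assoc)
  with assms show ?thesis by (simp add: m_assoc inv_mult_group)
qed

lemma (in group) lower_central_series_normal: "lower_central_series G n \<lhd> G"
proof (induction n)
  case 0
  show ?case by (simp add: normal_self)
next
  case (Suc n)
  interpret N: normal "lower_central_series G n" G by fact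
  show ?case
    unfolding lower_central_series.simps
  proof (rule normal_generateI, goal_cases)
    case 1
    show ?case using N.subset by auto
  next
    case (2 h g)
    then obtain x y where x: "x \<in> lower_central_series G n" and y: "y \<in> carrier G"
      and h: "h = x \<otimes> y \<otimes> inv x \<otimes> inv y" by blast
    have "g \<otimes> x \<otimes> inv g \<in> lower_central_series G n"
      using x 2(2) by (rule N.inv_op_closed2[rotated])
    moreover have "g \<otimes> y \<otimes> inv g \<in> carrier G" using y 2 by simp
    ultimately show ?case
      unfolding h using conj_commutator[OF 2(2) _ y, of x] x N.subset by blast
  qed
qed

lemma (in group) commutator_in_lower_central_series:
  assumes "x \<in> lower_central_series G n" "y \<in> carrier G"
  shows "x \<otimes> y \<otimes> inv x \<otimes> inv y \<in> lower_central_series G (Suc n)"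
  using assms by (auto intro!: generate.incl)

lemma (in group) commutator_eq_one_iff:
  assumes "x \<in> carrier G" "y \<in> carrier G"
  shows "x \<otimes> y \<otimes> inv x \<otimes> inv y = \<one> \<longleftrightarrow> x \<otimes> y = y \<otimes> x"
proof -
  have "x \<otimes> y \<otimes> inv x \<otimes> inv y = (x \<otimes> y) \<otimes> inv (y \<otimes> x)"
    using assms by (simp add: m_assoc inv_mult_group)
  then show ?thesis
    using assms by (metis inv_closed inv_inv inv_solve_right l_one m_closed one_closed)
qed

text \<open>
  The previous criterion applied in the quotient by \<open>H\<close>, where the commutator is central.
\<close>

lemma (in normal) coprime_commutator_in_normal:
  assumes xy: "x \<in> carrier G" "y \<in> carrier G"
    and pow: "x [^] (a::nat) = \<one>" "y [^] (b::nat) = \<one>" "coprime a b"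
    and c: "c = x \<otimes> y \<otimes> inv x \<otimes> inv y"
    and central: "\<And>g. g \<in> carrier G \<Longrightarrow> c \<otimes> g \<otimes> inv c \<otimes> inv g \<in> H"
  shows "c \<in> H"
proof -
  let ?Q = "G Mod H"
  let ?h = "\<lambda>g. H #> g"
  have Q: "group ?Q" by (rule factorgroup_is_group)
  have h: "group_hom G ?Q ?h"
    by (intro group_hom.intro group_axioms Q group_hom_axioms.intro r_coset_hom_Mod)
  have cG: "c \<in> carrier G" using xy c by simp
  have ker: "?h g = \<one>\<^bsub>?Q\<^esub> \<longleftrightarrow> g \<in> H" if "g \<in> carrier G" for g
    using that subset coset_join1[of H g] coset_join2[of g H] subgroup_axioms
    by (auto simp: FactGroup_def)
  have hcl: "?h g \<in> carrier ?Q" if "g \<in> carrier G" for g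
    using group_hom.hom_closed[OF h that] .
  have hcomm: "?h (u \<otimes> v \<otimes> inv u \<otimes> inv v)
      = ?h u \<otimes>\<^bsub>?Q\<^esub> ?h v \<otimes>\<^bsub>?Q\<^esub> inv\<^bsub>?Q\<^esub> ?h u \<otimes>\<^bsub>?Q\<^esub> inv\<^bsub>?Q\<^esub> ?h v"
    if "u \<in> carrier G" "v \<in> carrier G" for u v
    using that by (simp only: group_hom.hom_mult[OF h] group_hom.hom_inv[OF h] m_closed inv_closed)
  have comm_iff: "?h u \<otimes>\<^bsub>?Q\<^esub> ?h v = ?h v \<otimes>\<^bsub>?Q\<^esub> ?h u \<longleftrightarrow> u \<otimes> v \<otimes> inv u \<otimes> inv v \<in> H"
    if "u \<in> carrier G" "v \<in> carrier G" for u v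
    using group.commutator_eq_one_iff[OF Q hcl[OF that(1)] hcl[OF that(2)]]
      hcomm[OF that] ker[of "u \<otimes> v \<otimes> inv u \<otimes> inv v"] that by simp
  have "?h x \<otimes>\<^bsub>?Q\<^esub> ?h y = ?h y \<otimes>\<^bsub>?Q\<^esub> ?h x"
  proof (rule group.commute_if_commutator_commutes[OF Q hcl[OF xy(1)] hcl[OF xy(2)] _ _ _ _ _ pow(3)])
    show "?h c = ?h x \<otimes>\<^bsub>?Q\<^esub> ?h y \<otimes>\<^bsub>?Q\<^esub> inv\<^bsub>?Q\<^esub> ?h x \<otimes>\<^bsub>?Q\<^esub> inv\<^bsub>?Q\<^esub> ?h y"
      unfolding c by (rule hcomm[OF xy])
    show "?h x [^]\<^bsub>?Q\<^esub> a = \<one>\<^bsub>?Q\<^esub>" "?h y [^]\<^bsub>?Q\<^esub> b = \<one>\<^bsub>?Q\<^esub>"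
      using pow xy by (metis group_hom.hom_nat_pow[OF h] group_hom.hom_one[OF h])+
    show "?h c \<otimes>\<^bsub>?Q\<^esub> ?h x = ?h x \<otimes>\<^bsub>?Q\<^esub> ?h c" "?h c \<otimes>\<^bsub>?Q\<^esub> ?h y = ?h y \<otimes>\<^bsub>?Q\<^esub> ?h c"
      using comm_iff[OF cG] central xy by auto
  qed
  then show ?thesis using comm_iff[OF xy] c by simp
qed

text \<open>
  The commutator of \<open>x\<close> and \<open>y\<close> moves down the lower central series: once it lies in a term, it is
  central modulo the next term and therefore lies in that one too. This replaces the usual
  argument through normality of the Sylow subgroups.
\<close>

theorem nilpotent_coprime_commute:
  fixes G (structure)
  assumes nil: "nilpotent_group G"
    and xy: "x \<in> carrier G" "y \<in> carrier G"
    and pow: "x [^] (a::nat) = \<one>" "y [^] (b::nat) = \<one>" "coprime a b"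
  shows "x \<otimes> y = y \<otimes> x"
proof -
  have G: "group G" using nil by (simp add: nilpotent_group_def)
  then interpret group G .
  define c where "c = x \<otimes> y \<otimes> inv x \<otimes> inv y"
  have "c \<in> lower_central_series G n" for n
  proof (induction n)
    case 0
    show ?case using xy by (simp add: c_def)
  next
    case (Suc n)
    show ?case
      using normal.coprime_commutator_in_normal[OF lower_central_series_normal xy pow c_def]
        commutator_in_lower_central_series[OF Suc] by blast
  qed
  moreover obtain n where "lower_central_series G n = {\<one>}"
    using nil unfolding nilpotent_group_def by blast
  ultimately have "c = \<one>" by blast
  then show ?thesis
    unfolding c_def using commutator_eq_one_iff xy by simp
qed

lemma (in group) lower_central_series_subgroup:
  assumes H: "subgroup H G"
  shows "lower_central_series (G\<lparr>carrier := H\<rparr>) n \<subseteq> lower_central_series G n"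
proof (induction n)
  case 0
  show ?case using subgroup.subset[OF H] by simp
next
  case (Suc n)
  let ?H = "G\<lparr>carrier := H\<rparr>"
  interpret H: group ?H using H by (rule subgroup_imp_group)
  have le: "lower_central_series ?H n \<subseteq> H"
    using subgroup.subset[OF normal_imp_subgroup[OF H.lower_central_series_normal]] by simp
  define K where "K = (\<Union>x\<in>lower_central_series ?H n. \<Union>y\<in>H. {x \<otimes> y \<otimes> inv x \<otimes> inv y})"
  have "K = (\<Union>x\<in>lower_central_series ?H n. \<Union>y\<in>carrier ?H.
      {x \<otimes>\<^bsub>?H\<^esub> y \<otimes>\<^bsub>?H\<^esub> inv\<^bsub>?H\<^esub> x \<otimes>\<^bsub>?H\<^esub> inv\<^bsub>?H\<^esub> y})"
    unfolding K_def using le m_inv_consistent[OF H] by (intro SUP_cong) auto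
  then have "lower_central_series ?H (Suc n) = generate ?H K" by simp
  also have "\<dots> = generate G K"
    using le by (intro generate_consistent H)
      (auto simp: K_def intro!: subgroup.m_closed[OF H] subgroup.m_inv_closed[OF H])
  also have "\<dots> \<subseteq> lower_central_series G (Suc n)"
    unfolding K_def lower_central_series.simps
    using Suc subgroup.subset[OF H] by (intro mono_generate) blast
  finally show ?case .
qed

lemma (in group) nilpotent_subgroup:
  assumes "nilpotent_group G" and H: "subgroup H G"
  shows "nilpotent_group (G\<lparr>carrier := H\<rparr>)"
proof -
  interpret H: group "G\<lparr>carrier := H\<rparr>" using H by (rule subgroup_imp_group)
  obtain n where "lower_central_series G n = {\<one>}"
    using assms(1) unfolding nilpotent_group_def by blast
  then have "lower_central_series (G\<lparr>carrier := H\<rparr>) n = {\<one>}"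
    using lower_central_series_subgroup[OF H, of n]
      subgroup.one_closed[OF normal_imp_subgroup[OF H.lower_central_series_normal[of n]]] by auto
  then show ?thesis unfolding nilpotent_group_def using H.is_group by auto
qed

lemma (in group) centralizer_subgroup:
  assumes "S \<subseteq> carrier G"
  shows "subgroup {g \<in> carrier G. \<forall>s\<in>S. g \<otimes> s = s \<otimes> g} G"
proof (rule subgroupI)
  fix g assume g: "g \<in> {g \<in> carrier G. \<forall>s\<in>S. g \<otimes> s = s \<otimes> g}"
  have "inv g \<otimes> s = s \<otimes> inv g" if "s \<in> S" for s
  proof -
    have carr: "g \<in> carrier G" "s \<in> carrier G" and eq: "g \<otimes> s = s \<otimes> g"
      using g that assms by auto
    have "inv g \<otimes> s = inv g \<otimes> (s \<otimes> g) \<otimes> inv g" using carr by (simp add: m_assoc)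
    also have "\<dots> = s \<otimes> inv g" unfolding eq[symmetric] using carr by (simp flip: m_assoc)
    finally show ?thesis .
  qed
  then show "inv g \<in> {g \<in> carrier G. \<forall>s\<in>S. g \<otimes> s = s \<otimes> g}" using g by auto
next
  fix g h assume gh: "g \<in> {g \<in> carrier G. \<forall>s\<in>S. g \<otimes> s = s \<otimes> g}" "h \<in> {g \<in> carrier G. \<forall>s\<in>S. g \<otimes> s = s \<otimes> g}"
  have "(g \<otimes> h) \<otimes> s = s \<otimes> (g \<otimes> h)" if "s \<in> S" for s
  proof -
    have carr: "g \<in> carrier G" "h \<in> carrier G" "s \<in> carrier G"
      and eq: "g \<otimes> s = s \<otimes> g" "h \<otimes> s = s \<otimes> h"
      using gh that assms by auto
    have "(g \<otimes> h) \<otimes> s = (g \<otimes> s) \<otimes> h" using carr eq(2) by (simp add: m_assoc)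
    also have "\<dots> = s \<otimes> (g \<otimes> h)" unfolding eq(1) using carr by (simp add: m_assoc)
    finally show ?thesis .
  qed
  then show "g \<otimes> h \<in> {g \<in> carrier G. \<forall>s\<in>S. g \<otimes> s = s \<otimes> g}"
    using gh by auto
next
  have "\<one> \<in> {g \<in> carrier G. \<forall>s\<in>S. g \<otimes> s = s \<otimes> g}" using assms by auto
  then show "{g \<in> carrier G. \<forall>s\<in>S. g \<otimes> s = s \<otimes> g} \<noteq> {}" by blast
qed blast

lemma (in group) generate_commute:
  assumes "S \<subseteq> carrier G" and "\<And>x y. x \<in> S \<Longrightarrow> y \<in> S \<Longrightarrow> x \<otimes> y = y \<otimes> x"
    and "x \<in> generate G S" "y \<in> generate G S"
  shows "x \<otimes> y = y \<otimes> x"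
proof -
  have 1: "generate G S \<subseteq> {g \<in> carrier G. \<forall>s\<in>S. g \<otimes> s = s \<otimes> g}"
    using assms by (intro generate_subgroup_incl centralizer_subgroup) auto
  have "generate G S \<subseteq> {g \<in> carrier G. \<forall>s\<in>generate G S. g \<otimes> s = s \<otimes> g}"
  proof (rule generate_subgroup_incl[OF _ centralizer_subgroup[OF generate_incl[OF assms(1)]]])
    show "S \<subseteq> {g \<in> carrier G. \<forall>s\<in>generate G S. g \<otimes> s = s \<otimes> g}"
      using assms(1) 1 by (auto simp: subset_iff)
  qed
  then show ?thesis using assms(3,4) by blast
qed

text \<open>
  A normal abelian subgroup \<open>A\<close> of largest order works. If its centralizer \<open>C\<close> were larger, take
  the last term of the lower central series whose intersection with \<open>C\<close> is not contained in \<open>A\<close>,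
  and \<open>c\<close> in that intersection but not in \<open>A\<close>. All commutators of \<open>c\<close> lie in \<open>A\<close>, so \<open>A\<close> and \<open>c\<close>
  generate a larger normal abelian subgroup.
\<close>

theorem self_centralizing_normal_abelian_subgroup:
  fixes G (structure)
  assumes nil: "nilpotent_group G" and fin: "finite (carrier G)"
  obtains A where "A \<lhd> G" "\<And>a b. a \<in> A \<Longrightarrow> b \<in> A \<Longrightarrow> a \<otimes> b = b \<otimes> a"
    "\<And>g. g \<in> carrier G \<Longrightarrow> (\<And>a. a \<in> A \<Longrightarrow> g \<otimes> a = a \<otimes> g) \<Longrightarrow> g \<in> A"
proof -
  have G: "group G" using nil by (simp add: nilpotent_group_def)
  then interpret group G .
  define F where "F = {A. A \<lhd> G \<and> (\<forall>a\<in>A. \<forall>b\<in>A. a \<otimes> b = b \<otimes> a)}"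
  have "F \<subseteq> Pow (carrier G)"
    unfolding F_def by (auto dest!: normal_imp_subgroup subgroup.subset)
  then have finF: "finite F" using fin by (simp add: finite_subset)
  have "{\<one>} \<in> F" unfolding F_def using one_is_normal by simp
  then obtain A where A: "A \<in> F" and max: "\<And>B. B \<in> F \<Longrightarrow> \<not> card A < card B"
    using Max_in[of "card ` F"] Max_ge[of "card ` F"] finF
    by (metis (no_types, lifting) empty_iff finite_imageI image_eqI image_iff image_is_empty not_le)
  have nA: "A \<lhd> G" and abA: "\<And>a b. a \<in> A \<Longrightarrow> b \<in> A \<Longrightarrow> a \<otimes> b = b \<otimes> a"
    using A by (auto simp: F_def)
  have sA: "A \<subseteq> carrier G" using nA normal_imp_subgroup subgroup.subset by blast
  note sgA = normal_imp_subgroup[OF nA]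
  define C where "C = {g \<in> carrier G. \<forall>s\<in>A. g \<otimes> s = s \<otimes> g}"
  have sgC: "subgroup C G" unfolding C_def using sA by (rule centralizer_subgroup)
  have conjC: "g \<otimes> c \<otimes> inv g \<in> C" if "c \<in> C" "g \<in> carrier G" for c g
  proof -
    have "g \<otimes> c \<otimes> inv g \<otimes> s = s \<otimes> (g \<otimes> c \<otimes> inv g)" if s: "s \<in> A" for s
    proof -
      have "inv g \<otimes> s \<otimes> g \<in> A"
        using normal.inv_op_closed1[OF nA] s \<open>g \<in> carrier G\<close> by blast
      then have eq: "c \<otimes> (inv g \<otimes> s \<otimes> g) = (inv g \<otimes> s \<otimes> g) \<otimes> c"
        using \<open>c \<in> C\<close> by (simp add: C_def)
      have carr: "c \<in> carrier G" "s \<in> carrier G" "g \<in> carrier G"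
        using s sA \<open>c \<in> C\<close> \<open>g \<in> carrier G\<close> by (auto simp: C_def)
      have canc: "g \<otimes> (inv g \<otimes> z) = z" "inv g \<otimes> (g \<otimes> z) = z" if "z \<in> carrier G" for z
        using carr that by (simp_all flip: m_assoc)
      have "g \<otimes> c \<otimes> inv g \<otimes> s = g \<otimes> (c \<otimes> (inv g \<otimes> s \<otimes> g)) \<otimes> inv g"
        using carr by (simp add: m_assoc)
      also have "\<dots> = s \<otimes> (g \<otimes> c \<otimes> inv g)"
        unfolding eq using carr by (simp add: m_assoc canc)
      finally show ?thesis .
    qed
    then show ?thesis using that by (simp add: C_def)
  qed
  have "C \<subseteq> A"
  proof (rule ccontr)
    assume "\<not> C \<subseteq> A"
    obtain N where "lower_central_series G N = {\<one>}"
      using nil unfolding nilpotent_group_def by blast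
    then have "lower_central_series G N \<inter> C \<subseteq> A"
      using subgroup.one_closed[OF sgA] by auto
    moreover have "\<not> lower_central_series G 0 \<inter> C \<subseteq> A"
      using \<open>\<not> C \<subseteq> A\<close> by (auto simp: C_def)
    ultimately obtain m where m: "\<not> lower_central_series G m \<inter> C \<subseteq> A"
        "lower_central_series G (Suc m) \<inter> C \<subseteq> A"
      using ex_least_nat_less[of "\<lambda>n. lower_central_series G n \<inter> C \<subseteq> A" N] by blast
    then obtain c where c: "c \<in> lower_central_series G m" "c \<in> C" "c \<notin> A" by blast
    have cG: "c \<in> carrier G" using c by (simp add: C_def)
    have comm: "g \<otimes> c \<otimes> inv g \<otimes> inv c \<in> A" if g: "g \<in> carrier G" for g
    proof -
      have "c \<otimes> g \<otimes> inv c \<otimes> inv g \<in> lower_central_series G (Suc m)"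
        using c(1) g by (rule commutator_in_lower_central_series)
      moreover have "c \<otimes> (g \<otimes> inv c \<otimes> inv g) \<in> C"
        using sgC c(2) conjC g by (meson subgroup.m_closed subgroup.m_inv_closed)
      then have "c \<otimes> g \<otimes> inv c \<otimes> inv g \<in> C"
        using cG g by (simp add: m_assoc)
      ultimately have "inv (c \<otimes> g \<otimes> inv c \<otimes> inv g) \<in> A"
        using m(2) subgroup.m_inv_closed[OF sgA] by blast
      moreover have "inv (c \<otimes> g \<otimes> inv c \<otimes> inv g) = g \<otimes> c \<otimes> inv g \<otimes> inv c"
        using cG g by (simp add: inv_mult_group m_assoc)
      ultimately show ?thesis by simp
    qed
    (* The coset A c is included so that the generating set is closed under conjugation:
       g c g^-1 is the commutator of g and c, which is in A, times c. *)
    let ?H = "A \<union> (\<lambda>a. a \<otimes> c) ` A"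
    let ?B = "generate G ?H"
    have sH: "?H \<subseteq> carrier G" using sA cG by auto
    have "?B \<lhd> G"
    proof (rule normal_generateI[OF sH])
      fix h g assume h: "h \<in> ?H" and g: "g \<in> carrier G"
      have conjA: "g \<otimes> a \<otimes> inv g \<in> A" if "a \<in> A" for a
        using normal.inv_op_closed2[OF nA g that] .
      from h consider "h \<in> A" | a where "a \<in> A" "h = a \<otimes> c" by blast
      then show "g \<otimes> h \<otimes> inv g \<in> ?H"
      proof cases
        case 1
        then show ?thesis using conjA by blast
      next
        case 2
        have canc: "inv g \<otimes> (g \<otimes> z) = z" "inv c \<otimes> (c \<otimes> z) = z" if "z \<in> carrier G" for z
          using g cG that by (simp_all flip: m_assoc)
        have "g \<otimes> h \<otimes> inv g = ((g \<otimes> a \<otimes> inv g) \<otimes> (g \<otimes> c \<otimes> inv g \<otimes> inv c)) \<otimes> c"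
          using 2 g cG sA by (simp add: m_assoc canc subset_iff)
        moreover have "(g \<otimes> a \<otimes> inv g) \<otimes> (g \<otimes> c \<otimes> inv g \<otimes> inv c) \<in> A"
          using conjA[OF 2(1)] comm[OF g] subgroup.m_closed[OF sgA] by blast
        ultimately show ?thesis by blast
      qed
    qed
    moreover have "x \<otimes> y = y \<otimes> x" if "x \<in> ?B" "y \<in> ?B" for x y
    proof (rule generate_commute[OF sH _ that])
      have ac: "a \<otimes> c = c \<otimes> a" if "a \<in> A" for a using c(2) that by (simp add: C_def)
      have mixed: "a \<otimes> (b \<otimes> c) = (b \<otimes> c) \<otimes> a" if "a \<in> A" "b \<in> A" for a b
      proof -
        have carr: "a \<in> carrier G" "b \<in> carrier G" using that sA by auto
        have "a \<otimes> (b \<otimes> c) = (b \<otimes> a) \<otimes> c"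
          using carr cG abA[OF that] by (simp flip: m_assoc)
        also have "\<dots> = b \<otimes> (a \<otimes> c)" using carr cG by (simp add: m_assoc)
        also have "\<dots> = (b \<otimes> c) \<otimes> a" using carr cG ac[OF that(1)] by (simp add: m_assoc)
        finally show ?thesis .
      qed
      have both: "(a \<otimes> c) \<otimes> (b \<otimes> c) = (b \<otimes> c) \<otimes> (a \<otimes> c)" if "a \<in> A" "b \<in> A" for a b
      proof -
        have carr: "a \<in> carrier G" "b \<in> carrier G" using that sA by auto
        have "(a \<otimes> c) \<otimes> (b \<otimes> c) = (c \<otimes> a) \<otimes> (b \<otimes> c)" using ac[OF that(1)] by simp
        also have "\<dots> = c \<otimes> ((b \<otimes> c) \<otimes> a)" using carr cG mixed[OF that] by (simp add: m_assoc)
        also have "\<dots> = (c \<otimes> b) \<otimes> (c \<otimes> a)" using carr cG by (simp add: m_assoc)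
        finally show ?thesis using ac[OF that(1)] ac[OF that(2)] by simp
      qed
      fix x y assume "x \<in> ?H" "y \<in> ?H"
      then show "x \<otimes> y = y \<otimes> x"
        using abA mixed both by (elim UnE imageE) (auto simp only:)
    qed
    ultimately have BF: "?B \<in> F" by (simp add: F_def)
    have "\<one> \<otimes> c \<in> ?H" using subgroup.one_closed[OF sgA] by blast
    then have "c \<in> ?B" using cG by (metis generate.incl l_one)
    moreover have "A \<subseteq> ?B" by (auto intro: generate.incl)
    moreover have "finite ?B" by (rule finite_subset[OF generate_incl[OF sH] fin])
    ultimately have "A \<subset> ?B" "finite ?B" using c(3) by blast+
    then have "card A < card ?B" by (rule psubset_card_mono[rotated])
    then show False using max[OF BF] by blast
  qed
  then show thesis
    using that[OF nA abA] unfolding C_def by blast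
qed

section \<open>Cyclic subgroups and coprime orders\<close>

lemma (in group) subgroup_pow_card:
  assumes "subgroup A G" "a \<in> A"
  shows "a [^] card A = \<one>"
proof -
  interpret A: group "G\<lparr>carrier := A\<rparr>" using assms(1) by (rule subgroup_imp_group)
  show ?thesis
    using A.pow_order_eq_1[of a] assms(2) by (simp add: order_def flip: nat_pow_consistent)
qed

lemma (in group) cyclic_subgroup_iff:
  assumes "subgroup A G"
  shows "cyclic_group (G\<lparr>carrier := A\<rparr>) \<longleftrightarrow> (\<exists>a\<in>A. A = generate G {a})"
proof -
  interpret A: group "G\<lparr>carrier := A\<rparr>" using assms by (rule subgroup_imp_group)
  have "generate G {a} = range (\<lambda>n::int. a [^]\<^bsub>G\<lparr>carrier := A\<rparr>\<^esub> n)" if "a \<in> A" for a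
    using generate_pow[of a] int_pow_consistent[OF assms that] that subgroup.subset[OF assms]
    by auto
  then show ?thesis unfolding A.cyclic_group by auto
qed

lemma (in group) generate_singleton_mono:
  assumes "a \<in> carrier G" "b \<in> generate G {a}"
  shows "generate G {b} \<subseteq> generate G {a}"
  using assms by (intro generate_subgroup_incl generate_is_subgroup) auto

lemma (in group) int_pow_in_generate:
  "a \<in> carrier G \<Longrightarrow> a [^] (i::int) \<in> generate G {a}"
  by (auto simp: generate_pow)

text \<open>
  By a Bezout identity for \<open>m\<close> and \<open>n\<close>, suitable powers of \<open>a b\<close> kill one factor and fix the other.
\<close>

lemma (in group) coprime_parts_in_generate:
  assumes ab: "a \<in> carrier G" "b \<in> carrier G" "a \<otimes> b = b \<otimes> a"
    and pow: "a [^] (m::nat) = \<one>" "b [^] (n::nat) = \<one>" "coprime m n"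
  shows "a \<in> generate G {a \<otimes> b}" "b \<in> generate G {a \<otimes> b}"
proof -
  obtain u v :: int where uv: "u * int m + v * int n = 1"
    using pow(3) by (metis bezout_int coprime_imp_gcd_eq_1 coprime_int_iff)
  have am: "int (ord a) dvd int m" and bn: "int (ord b) dvd int n"
    using pow ab by (simp_all add: pow_eq_id)
  have "(a \<otimes> b) [^] (v * int n) = a"
  proof -
    have "a [^] (v * int n) = a [^] (1::int)"
      unfolding int_pow_eq[OF ab(1)] using am uv
      by (metis add_diff_cancel_right' dvd_mult)
    moreover have "b [^] (v * int n) = \<one>"
      using bn ab int_pow_eq_id by simp
    ultimately show ?thesis using int_pow_mult_distrib[OF ab(3,1,2)] ab by simp
  qed
  then show "a \<in> generate G {a \<otimes> b}"
    using int_pow_in_generate[of "a \<otimes> b"] ab(1,2) by (metis m_closed)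
  have "(a \<otimes> b) [^] (u * int m) = b"
  proof -
    have "b [^] (u * int m) = b [^] (1::int)"
      unfolding int_pow_eq[OF ab(2)] using bn uv
      by (metis add_diff_cancel_left' dvd_mult)
    moreover have "a [^] (u * int m) = \<one>"
      using am ab int_pow_eq_id by simp
    ultimately show ?thesis using int_pow_mult_distrib[OF ab(3,1,2)] ab by simp
  qed
  then show "b \<in> generate G {a \<otimes> b}"
    using int_pow_in_generate[of "a \<otimes> b"] ab(1,2) by (metis m_closed)
qed

text \<open>
  A cyclic \<open>p\<close>-group has its elements of order \<open>p\<close> in each of its nontrivial subgroups: with
  \<open>v = w\<^sup>j\<close>, the group generated by \<open>v\<close> is that of \<open>w\<^sup>d\<close> for \<open>d = gcd j p\<^sup>k = p\<^sup>b\<close>, \<open>b < k\<close>, while \<open>a\<close>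
  is a power of \<open>w\<close> with exponent divisible by \<open>p\<^sup>k\<^sup>-\<^sup>1\<close>.
\<close>

lemma (in group) prime_order_mem_cyclic:
  assumes p: "Factorial_Ring.prime p" and w: "w \<in> carrier G" "ord w = p ^ k"
    and a: "a \<in> generate G {w}" "a [^] (p::nat) = \<one>"
    and v: "v \<in> generate G {w}" "v \<noteq> \<one>"
  shows "a \<in> generate G {v}"
proof -
  have ord0: "ord w \<noteq> 0" using w(2) p by (simp add: prime_gt_0_nat)
  obtain i j :: nat where i: "a = w [^] i" and j: "v = w [^] j"
    using a(1) v(1) generate_pow_nat[OF w(1) ord0] by auto
  have vG: "v \<in> carrier G" using j w by simp
  obtain b where b: "b \<le> k" "gcd j (p ^ k) = p ^ b"
    using divides_primepow_nat[OF p] gcd_dvd2 by blast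
  have "b \<noteq> k"
  proof
    assume "b = k"
    then have "ord w dvd j" using b w by (metis gcd_dvd1)
    then show False using v(2) j w by (simp add: pow_eq_id)
  qed
  then obtain k' where k': "k = Suc k'" "b \<le> k'" using b(1) by (cases k) auto
  have "w [^] (i * p) = \<one>" using a(2) i w by (simp add: nat_pow_pow)
  then have "p ^ k dvd i * p" using w by (simp add: pow_eq_id)
  then have "p ^ k' dvd i" using k' p by (simp add: mult.commute)
  then obtain q where q: "i = p ^ b * q" using k'(2) by (meson dvdE le_imp_power_dvd dvd_trans)
  obtain r s :: int where rs: "r * int j + s * int (p ^ k) = int (p ^ b)"
    using bezout_int[of "int j" "int (p ^ k)"] b(2) by (metis gcd_int_int_eq)
  have "v [^] (r * int q) = w [^] (int j * (r * int q))"
    unfolding j using w by (simp add: int_pow_pow flip: int_pow_int)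
  also have "\<dots> = w [^] int i"
  proof -
    have "int i - int j * (r * int q) = int (ord w) * (s * int q)"
      unfolding q w(2) using arg_cong[OF rs, of "\<lambda>t. t * int q"]
      by (simp add: algebra_simps)
    then show ?thesis unfolding int_pow_eq[OF w(1)] by simp
  qed
  also have "\<dots> = a" using i by (simp add: int_pow_int)
  finally show ?thesis using int_pow_in_generate[OF vG, of "r * int q"] by simp
qed

locale commuting_coprime_subgroups = group +
  fixes A B
  assumes subA: "subgroup A G" and subB: "subgroup B G"
    and commute: "\<And>a b. a \<in> A \<Longrightarrow> b \<in> B \<Longrightarrow> a \<otimes> b = b \<otimes> a"
    and coprime_card: "coprime (card A) (card B)"
begin

lemma in_carrier [simp]: "a \<in> A \<Longrightarrow> a \<in> carrier G" "b \<in> B \<Longrightarrow> b \<in> carrier G"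
  using subA subB subgroup.subset by blast+

lemma parts_in_generate:
  assumes "a \<in> A" "b \<in> B"
  shows "a \<in> generate G {a \<otimes> b}" "b \<in> generate G {a \<otimes> b}"
  using coprime_parts_in_generate[OF _ _ commute[OF assms]
      subgroup_pow_card[OF subA assms(1)] subgroup_pow_card[OF subB assms(2)] coprime_card]
    assms by simp_all

lemma inter_trivial: "A \<inter> B = {\<one>}"
proof -
  have "x = \<one>" if "x \<in> A" "x \<in> B" for x
  proof -
    have "ord x dvd card A" "ord x dvd card B"
      using that subgroup_pow_card[OF subA] subgroup_pow_card[OF subB] by (auto simp flip: pow_eq_id)
    then have "ord x = 1" using coprime_card coprime_common_divisor_nat by blast
    then show ?thesis using that ord_eq_1 by simp
  qed
  then show ?thesis using subA subB subgroup.one_closed by fastforce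
qed

lemma decomposition_unique:
  assumes "a \<in> A" "b \<in> B" "a' \<in> A" "b' \<in> B" "a \<otimes> b = a' \<otimes> b'"
  shows "a = a'" "b = b'"
proof -
  have "inv a' \<otimes> a = b' \<otimes> inv b"
    using assms by (metis in_carrier inv_closed inv_solve_left inv_solve_right m_assoc m_closed)
  moreover have "inv a' \<otimes> a \<in> A" "b' \<otimes> inv b \<in> B"
    using assms subA subB by (auto simp: subgroup.m_closed subgroup.m_inv_closed)
  ultimately have "inv a' \<otimes> a = \<one>" "b' \<otimes> inv b = \<one>"
    using inter_trivial by auto
  then show "a = a'" "b = b'"
    using assms by (metis in_carrier inv_closed inv_equality inv_inv)+
qed

lemma subgroup_set_mult: "subgroup (A <#> B) G"
proof (rule subgroupI)
  show "A <#> B \<subseteq> carrier G" by (auto simp: set_mult_def)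
  show "A <#> B \<noteq> {}"
    using subgroup.one_closed[OF subA] subgroup.one_closed[OF subB] by (auto simp: set_mult_def)
next
  fix g assume "g \<in> A <#> B"
  then obtain a b where "a \<in> A" "b \<in> B" "g = a \<otimes> b" by (auto simp: set_mult_def)
  moreover from this have "inv g = inv a \<otimes> inv b"
    using commute[of a b] by (metis in_carrier inv_mult_group)
  ultimately show "inv g \<in> A <#> B"
    using subgroup.m_inv_closed[OF subA] subgroup.m_inv_closed[OF subB] by (auto simp: set_mult_def)
next
  fix g h assume "g \<in> A <#> B" "h \<in> A <#> B"
  then obtain a b c d where *: "a \<in> A" "b \<in> B" "g = a \<otimes> b" "c \<in> A" "d \<in> B" "h = c \<otimes> d"
    by (auto simp: set_mult_def)
  have "g \<otimes> h = a \<otimes> (b \<otimes> c) \<otimes> d" using * by (simp add: m_assoc)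
  also have "\<dots> = (a \<otimes> c) \<otimes> (b \<otimes> d)" using * commute[of c b, symmetric] by (simp flip: m_assoc)
  finally have "g \<otimes> h = (a \<otimes> c) \<otimes> (b \<otimes> d)" .
  moreover have "a \<otimes> c \<in> A" "b \<otimes> d \<in> B"
    using * subgroup.m_closed[OF subA] subgroup.m_closed[OF subB] by auto
  ultimately show "g \<otimes> h \<in> A <#> B" unfolding set_mult_def by blast
qed

lemma card_set_mult:
  assumes "D \<subseteq> A"
  shows "card (D <#> B) = card D * card B"
proof -
  have "inj_on (\<lambda>(a, b). a \<otimes> b) (D \<times> B)"
  proof (rule inj_onI, clarify)
    fix a b a' b'
    assume "a \<in> D" "b \<in> B" "a' \<in> D" "b' \<in> B" "a \<otimes> b = a' \<otimes> b'"
    then show "a = a' \<and> b = b'"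
      using assms decomposition_unique[of a b a' b'] by blast
  qed
  moreover have "D <#> B = (\<lambda>(a, b). a \<otimes> b) ` (D \<times> B)"
    by (auto simp: set_mult_def)
  ultimately show ?thesis by (simp add: card_image card_cartesian_product)
qed

lemma cyclic_set_mult:
  assumes "A = generate G {a}" "a \<in> A" "B = generate G {b}" "b \<in> B"
  shows "A <#> B = generate G {a \<otimes> b}"
proof
  have ab: "a \<otimes> b \<in> carrier G" using assms by simp
  have "A \<subseteq> generate G {a \<otimes> b}" "B \<subseteq> generate G {a \<otimes> b}"
    using generate_singleton_mono[OF ab] parts_in_generate[of a b] assms by blast+
  then show "A <#> B \<subseteq> generate G {a \<otimes> b}"
    unfolding set_mult_def by (auto intro: generate.eng)
  show "generate G {a \<otimes> b} \<subseteq> A <#> B"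
    using assms by (intro generate_subgroup_incl subgroup_set_mult) (auto simp: set_mult_def)
qed

text \<open>
  A generator \<open>w e\<close> of a cyclic subgroup projects to the generator \<open>w\<close> of its \<open>A\<close>-part. Conversely,
  \<open>w q\<close> generates a subgroup that contains \<open>w\<close> and all of \<open>B\<close>. So the \<open>B\<close>-components
  do not affect adjacency in the enhanced power graph.
\<close>

lemma common_cyclic_iff:
  assumes G: "carrier G = A <#> B" and B: "B = generate G {q}" "q \<in> B"
    and uv: "u \<in> A" "c \<in> B" "v \<in> A" "d \<in> B"
  shows "(\<exists>z\<in>carrier G. u \<otimes> c \<in> generate G {z} \<and> v \<otimes> d \<in> generate G {z}) \<longleftrightarrow>
    (\<exists>w\<in>A. u \<in> generate G {w} \<and> v \<in> generate G {w})"
proof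
  assume "\<exists>z\<in>carrier G. u \<otimes> c \<in> generate G {z} \<and> v \<otimes> d \<in> generate G {z}"
  then obtain w e where we: "w \<in> A" "e \<in> B"
    and z: "u \<otimes> c \<in> generate G {w \<otimes> e}" "v \<otimes> d \<in> generate G {w \<otimes> e}"
    unfolding G set_mult_def by blast
  have part: "a \<in> generate G {w}" if a: "a \<in> A" "b \<in> B" "a \<otimes> b \<in> generate G {w \<otimes> e}" for a b
  proof -
    obtain i :: int where "a \<otimes> b = (w \<otimes> e) [^] i"
      using a(3) generate_pow[of "w \<otimes> e"] we by auto
    also have "\<dots> = w [^] i \<otimes> e [^] i"
      using we commute by (intro int_pow_mult_distrib) auto
    finally have "a = w [^] i"
      using decomposition_unique(1) a(1,2) we subA subB subgroup_int_pow_closed by metis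
    then show ?thesis using generate_pow[of w] we by auto
  qed
  show "\<exists>w\<in>A. u \<in> generate G {w} \<and> v \<in> generate G {w}"
    using part z uv we(1) by blast
next
  assume "\<exists>w\<in>A. u \<in> generate G {w} \<and> v \<in> generate G {w}"
  then obtain w where w: "w \<in> A" "u \<in> generate G {w}" "v \<in> generate G {w}" by blast
  have wq: "w \<otimes> q \<in> carrier G" using w B by simp
  have "generate G {w} \<subseteq> generate G {w \<otimes> q}" "B \<subseteq> generate G {w \<otimes> q}"
    using generate_singleton_mono[OF wq] parts_in_generate[of w q] w B by blast+
  then show "\<exists>z\<in>carrier G. u \<otimes> c \<in> generate G {z} \<and> v \<otimes> d \<in> generate G {z}"
    using w uv wq by (intro bexI[of _ "w \<otimes> q"]) (auto intro: generate.eng)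
qed

end

section \<open>Exponents of an automorphism of order p\<close>

lemma power_one_plus_cong:
  fixes p j :: int
  shows "[(1 + p * j) ^ i = 1 + int i * (p * j)] (mod p\<^sup>2)"
proof (induction i)
  case (Suc i)
  have "[(1 + p * j) * (1 + p * j) ^ i = (1 + p * j) * (1 + int i * (p * j))] (mod p\<^sup>2)"
    using Suc by (rule cong_scalar_left)
  moreover have "(1 + p * j) * (1 + int i * (p * j)) = 1 + int (Suc i) * (p * j) + p\<^sup>2 * (int i * j\<^sup>2)"
    by (simp add: algebra_simps power2_eq_square)
  ultimately show ?case
    by (simp add: cong_def)
qed simp

text \<open>
  With \<open>t = 1 + p j\<close> the sum is \<open>p + p j \<cdot> p (p - 1) / 2\<close> modulo \<open>p\<^sup>2\<close>; here \<open>p\<close> odd makes \<open>(p - 1) / 2\<close>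
  an integer.
\<close>

lemma geometric_sum_cong:
  fixes p :: nat and t :: int
  assumes "odd p" "[t = 1] (mod int p)"
  shows "[(\<Sum>i<p. t ^ i) = int p] (mod (int p)\<^sup>2)"
proof -
  obtain j where t: "t = 1 + int p * j"
    using assms(2) by (metis cong_iff_lin cong_sym mult.commute)
  have "[(\<Sum>i<p. t ^ i) = (\<Sum>i<p. 1 + int i * (int p * j))] (mod (int p)\<^sup>2)"
    unfolding t by (intro cong_sum power_one_plus_cong)
  moreover have "(\<Sum>i<p. 1 + int i * (int p * j)) = int p + (\<Sum>i<p. int i) * (int p * j)"
    by (simp add: sum.distrib sum_distrib_right)
  moreover have "(\<Sum>i<p. int i) = int p * ((int p - 1) div 2)"
  proof -
    have "2 * (\<Sum>i<n. int i) = int n * (int n - 1)" for n :: nat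
      by (induction n) (auto simp: algebra_simps)
    moreover have "2 * ((int p - 1) div 2) = int p - 1" using assms(1) by simp
    ultimately have "2 * (\<Sum>i<p. int i) = 2 * (int p * ((int p - 1) div 2))"
      by (metis mult.left_commute)
    then show ?thesis by simp
  qed
  ultimately have "[(\<Sum>i<p. t ^ i) = int p + (int p)\<^sup>2 * ((int p - 1) div 2 * j)] (mod (int p)\<^sup>2)"
    by (simp add: power2_eq_square ac_simps)
  then show ?thesis by (simp add: cong_def)
qed

lemma cong_1_if_power_prime_cong_1:
  fixes t p :: nat
  assumes "Factorial_Ring.prime p" "[t ^ p = 1] (mod p)"
  shows "[t = 1] (mod p)"
proof -
  have "\<not> p dvd t"
  proof
    assume "p dvd t"
    then have "p dvd t ^ p" using assms(1) by (simp add: dvd_power_iff prime_gt_0_nat dvd_trans)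
    then have "p dvd 1" using assms(2) cong_dvd_iff by blast
    then show False using assms(1) not_prime_unit by blast
  qed
  then have "[t ^ (p - 1) = 1] (mod p)" using assms(1) fermat_theorem by blast
  then have "[t ^ (p - 1) * t = 1 * t] (mod p)" by (rule cong_scalar_right)
  moreover have "t ^ (p - 1) * t = t ^ p"
    using prime_gt_0_nat[OF assms(1)] by (metis power_minus_mult)
  ultimately show ?thesis using assms(2) by (simp add: cong_def)
qed

lemma gcd_prime_mult_power:
  fixes p w :: int
  assumes "Factorial_Ring.prime p" "\<not> p dvd w" "k \<le> m"
  shows "gcd (p ^ k * w) (p ^ m) = p ^ k"
proof -
  have "coprime w (p ^ (m - k))"
    using assms(1,2) by (metis coprime_commute coprime_power_right_iff prime_imp_coprime)
  moreover have "p ^ m = p ^ k * p ^ (m - k)" using assms(3) by (simp flip: power_add)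
  moreover have "p > 0" using assms(1) prime_gt_0_int by blast
  ultimately show ?thesis by (simp add: gcd_mult_left)
qed

text \<open>
  The number theory behind the exceptional role of the quaternion groups. Let \<open>x\<close> have order \<open>N\<close>,
  and let \<open>u x u\<^sup>-\<^sup>1 = x\<^sup>t\<close>, \<open>u\<^sup>p = x\<^sup>s\<close>. The hypotheses say that \<open>u\<^sup>p\<close> commutes with \<open>x\<close>, that \<open>u\<close> does not,
  that \<open>u\<close> commutes with \<open>u\<^sup>p\<close>, and that no \<open>x\<^sup>i u\<close> has \<open>p\<close>-th power 1. Whenever the sum
  \<open>1 + t + \<dots> + t\<^sup>p\<^sup>-\<^sup>1\<close> is \<open>p\<close> times a number prime to \<open>p\<close>, its gcd with \<open>N\<close> is \<open>p\<close>, which divides \<open>s\<close>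
  (if \<open>s\<close> were prime to \<open>p\<close>, then \<open>N\<close> would divide \<open>t - 1\<close>), and that is excluded.
  Only \<open>p = 2\<close> and \<open>t \<equiv> 3\<close> modulo 4 escape, and then \<open>t\<^sup>2 \<equiv> 1\<close> leaves few possibilities for \<open>t\<close> and \<open>s\<close>.
\<close>

lemma inverting_exponent:
  fixes p m t :: nat and s :: int
  defines "N \<equiv> int p ^ m"
  assumes p: "Factorial_Ring.prime p"
    and tp: "[int t ^ p = 1] (mod N)" and t1: "\<not> [int t = 1] (mod N)"
    and st: "N dvd s * (int t - 1)"
    and no_sol: "\<not> gcd (\<Sum>i<p. int t ^ i) N dvd s"
  shows "p = 2 \<and> 2 \<le> m \<and> [int t = -1] (mod N) \<and> [s = 2 ^ (m - 1)] (mod N)"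
proof -
  let ?s = "\<Sum>i<p. int t ^ i"
  have pi: "Factorial_Ring.prime (int p)" using p by simp
  have m: "m \<ge> 1" using t1 unfolding N_def by (cases m) auto
  have pN: "int p dvd N" using m unfolding N_def by (simp add: dvd_power)
  have ps: "int p dvd s"
  proof (rule ccontr)
    assume "\<not> int p dvd s"
    then have "coprime N s" unfolding N_def
      using pi by (simp add: prime_imp_coprime)
    then have "N dvd int t - 1" using st coprime_dvd_mult_right_iff by blast
    then show False using t1 by (simp add: cong_iff_dvd_diff)
  qed
  have "[int t ^ p = 1] (mod int p)" using tp pN cong_dvd_modulus by blast
  then have "[t ^ p = 1] (mod p)"
    by (metis cong_int_iff of_nat_1 of_nat_power)
  then have tmod: "[int t = 1] (mod int p)"
    using cong_1_if_power_prime_cong_1[OF p] cong_int_iff by (metis of_nat_1)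
  then obtain j where t: "int t = 1 + int p * j"
    by (metis cong_iff_lin cong_sym mult.commute)
  (* A geometric sum exactly divisible by p would have gcd p with N, and p divides s. *)
  have not_p: False if w: "?s = int p * w" "\<not> int p dvd w" for w
    using gcd_prime_mult_power[OF pi w(2) m] no_sol ps w(1) unfolding N_def by simp
  have p2: "p = 2"
  proof (rule ccontr)
    assume "p \<noteq> 2"
    then have "odd p" using p primes_dvd_imp_eq two_is_prime_nat by blast
    then have "(int p)\<^sup>2 dvd ?s - int p"
      using geometric_sum_cong[OF _ tmod] by (simp add: cong_iff_dvd_diff)
    then obtain q where "?s - int p = (int p)\<^sup>2 * q" ..
    then have "?s = int p * (1 + int p * q)" by (simp add: algebra_simps power2_eq_square)
    moreover have "\<not> int p dvd 1 + int p * q"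
      using pi by (metis dvd_add_times_triv_right_iff mult.commute not_prime_unit)
    ultimately show False using not_p by blast
  qed
  have sig: "?s = 2 * (1 + j)" using t p2 by (simp add: numeral_2_eq_2)
  have oddj: "odd j"
    using not_p[of "1 + j"] sig p2 by auto
  have N: "N = 2 * 2 ^ (m - 1)" using m p2 unfolding N_def by (cases m) auto
  have cop: "coprime (2 ^ (m - 1)) j" using oddj by simp
  have s: "2 ^ (m - 1) dvd s"
  proof -
    have "2 * 2 ^ (m - 1) dvd 2 * (s * j)" using st t p2 unfolding N by (simp add: ac_simps)
    then have "2 ^ (m - 1) dvd s * j" by simp
    then show ?thesis using cop coprime_dvd_mult_left_iff by blast
  qed
  have "2 ^ (m - 1) dvd ?s"
  proof -
    have "N dvd int t ^ 2 - 1" using tp p2 by (simp add: cong_iff_dvd_diff)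
    moreover have "int t ^ 2 - 1 = 2 * (j * ?s)"
      using t p2 sig by (simp add: algebra_simps power2_eq_square)
    ultimately have "2 ^ (m - 1) dvd j * ?s" unfolding N by simp
    then show ?thesis using cop coprime_dvd_mult_right_iff by blast
  qed
  then obtain w where w: "?s = 2 ^ (m - 1) * w" ..
  have "even w"
  proof (rule ccontr)
    assume "odd w"
    then have "gcd ?s N = 2 ^ (m - 1)"
      using gcd_prime_mult_power[of 2 w "m - 1" m] w p2 unfolding N_def by simp
    then show False using no_sol s by simp
  qed
  then have Nsig: "N dvd ?s" using w unfolding N by auto
  then have "gcd ?s N = N" unfolding N_def by simp
  then have nNs: "\<not> N dvd s" using no_sol by simp
  obtain v where v: "s = 2 ^ (m - 1) * v" using s ..
  have "odd v" using nNs v unfolding N by auto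
  then have "even (v - 1)" by simp
  then have "N dvd 2 ^ (m - 1) * (v - 1)" unfolding N by auto
  then have "[s = 2 ^ (m - 1)] (mod N)"
    using v by (simp add: cong_iff_dvd_diff algebra_simps)
  moreover have neg: "[int t = -1] (mod N)"
    using Nsig sig t p2 by (simp add: cong_iff_dvd_diff algebra_simps)
  moreover have "m \<noteq> 1"
  proof
    assume "m = 1"
    then have "N = 2" using N by simp
    then show False using t1 t p2 by (simp add: cong_iff_dvd_diff)
  qed
  ultimately show ?thesis using p2 m by simp
qed

section \<open>Groups of prime power order with one subgroup of order p\<close>

lemma (in group) semi_commute_powers:
  fixes t i n :: nat
  assumes "x \<in> carrier G" "u \<in> carrier G" "u \<otimes> x = x [^] t \<otimes> u"
  shows "u [^] n \<otimes> x [^] i = x [^] (t ^ n * i) \<otimes> u [^] n"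
proof (induction n arbitrary: i)
  case (Suc n)
  have step: "u \<otimes> x [^] i = x [^] (t * i) \<otimes> u" for i :: nat
  proof (induction i)
    case (Suc i)
    have "u \<otimes> x [^] Suc i = (u \<otimes> x [^] i) \<otimes> x" using assms by (simp add: m_assoc)
    also have "\<dots> = x [^] (t * i) \<otimes> (u \<otimes> x)" unfolding Suc using assms by (simp add: m_assoc)
    also have "\<dots> = x [^] (t * i) \<otimes> x [^] t \<otimes> u" unfolding assms(3) using assms by (simp add: m_assoc)
    also have "\<dots> = x [^] (t * Suc i) \<otimes> u" using assms by (simp add: nat_pow_mult add.commute)
    finally show ?case .
  qed (use assms in simp)
  have "u [^] Suc n \<otimes> x [^] i = u [^] n \<otimes> (u \<otimes> x [^] i)" using assms by (simp add: m_assoc)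
  also have "\<dots> = (u [^] n \<otimes> x [^] (t * i)) \<otimes> u" unfolding step using assms by (simp add: m_assoc)
  also have "\<dots> = x [^] (t ^ n * (t * i)) \<otimes> u [^] Suc n" unfolding Suc using assms by (simp add: m_assoc)
  finally show ?case by (simp add: ac_simps)
qed (use assms in simp)

text \<open>
  Moving every \<open>u\<close> to the right turns the exponents of the factors \<open>x\<^sup>i\<close> into \<open>i, i t, i t\<^sup>2, \<dots>\<close>.
\<close>

lemma (in group) semi_commute_product_pow:
  fixes t i n :: nat
  assumes "x \<in> carrier G" "u \<in> carrier G" "u \<otimes> x = x [^] t \<otimes> u"
  shows "(x [^] i \<otimes> u) [^] n = x [^] (i * (\<Sum>j<n. t ^ j)) \<otimes> u [^] n"
proof (induction n)
  case (Suc n)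
  have "(x [^] i \<otimes> u) [^] Suc n = x [^] (i * (\<Sum>j<n. t ^ j)) \<otimes> (u [^] n \<otimes> x [^] i) \<otimes> u"
    using Suc assms by (simp add: m_assoc)
  also have "\<dots> = (x [^] (i * (\<Sum>j<n. t ^ j)) \<otimes> x [^] (t ^ n * i)) \<otimes> u [^] Suc n"
    unfolding semi_commute_powers[OF assms] using assms by (simp add: m_assoc)
  also have "x [^] (i * (\<Sum>j<n. t ^ j)) \<otimes> x [^] (t ^ n * i) = x [^] (i * (\<Sum>j<Suc n. t ^ j))"
    using assms by (simp add: nat_pow_mult algebra_simps)
  finally show ?case .
qed (use assms in simp)

lemma (in group) inverts_inv:
  assumes "x \<in> carrier G" "u \<in> carrier G" "u \<otimes> x = inv x \<otimes> u"
  shows "u \<otimes> inv x = x \<otimes> u"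
proof -
  have "u \<otimes> inv x = x \<otimes> (inv x \<otimes> u) \<otimes> inv x" using assms(1,2) by (simp flip: m_assoc)
  also have "\<dots> = x \<otimes> (u \<otimes> x) \<otimes> inv x" using assms(3) by simp
  also have "\<dots> = x \<otimes> u" using assms(1,2) by (simp add: m_assoc)
  finally show ?thesis .
qed

text \<open>
  If \<open>h\<close> acts on \<open>x\<close> by \<open>x \<mapsto> x\<^sup>t\<close> and \<open>h\<^sup>2\<close> by inversion, then \<open>t\<^sup>2 \<equiv> -1\<close> modulo 4.
\<close>

lemma (in group) inversion_not_square:
  fixes t :: nat
  assumes x: "x \<in> carrier G" and h: "h \<in> carrier G" and t: "h \<otimes> x = x [^] t \<otimes> h"
    and 4: "4 dvd ord x"
  shows "h [^] (2::nat) \<otimes> x \<noteq> inv x \<otimes> h [^] (2::nat)"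
proof
  assume inv: "h [^] (2::nat) \<otimes> x = inv x \<otimes> h [^] (2::nat)"
  have "x [^] (t\<^sup>2) \<otimes> h [^] (2::nat) = inv x \<otimes> h [^] (2::nat)"
    using semi_commute_powers[OF x h t, of 2 1] inv x by simp
  then have "x [^] (t\<^sup>2) = inv x" using x h by (simp only: right_cancel nat_pow_closed inv_closed)
  then have "x [^] int (t\<^sup>2) = x [^] (-1::int)"
    using x int_pow_int[of G x "t\<^sup>2"] by (simp only: int_pow_neg int_pow_1)
  then have "int (ord x) dvd - 1 - int (t\<^sup>2)" using int_pow_eq[OF x] by blast
  moreover have "(4::int) dvd int (ord x)" using 4 by presburger
  ultimately have "(4::int) dvd - 1 - int (t\<^sup>2)" using dvd_trans by blast
  then have "4 dvd t\<^sup>2 + 1" by presburger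
  moreover have "\<not> 4 dvd t\<^sup>2 + 1"
  proof (cases "even t")
    case True
    then obtain q where "t = 2 * q" by blast
    then have "t\<^sup>2 + 1 = 4 * (q * q) + 1" by (simp add: power2_eq_square)
    then show ?thesis by presburger
  next
    case False
    then obtain q where "t = 2 * q + 1" using oddE by blast
    then have "t\<^sup>2 + 1 = 4 * (q * q + q) + 2" by (simp add: power2_eq_square algebra_simps)
    then show ?thesis by presburger
  qed
  ultimately show False by blast
qed

text \<open>
  The multiplier is wanted as a natural number because it serves as an exponent of \<open>x\<close> in
  expressions with natural exponents.
\<close>

lemma nat_multiple_cong_if_gcd_dvd:
  fixes a s :: int and N :: nat
  assumes "gcd a (int N) dvd s" "N > 0"
  obtains i :: nat where "int N dvd int i * a + s"
proof -
  obtain q where q: "s = gcd a (int N) * q" using assms(1) ..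
  obtain u v where uv: "u * a + v * int N = gcd a (int N)" using bezout_int by blast
  define i where "i = nat ((- (u * q)) mod int N)"
  have i: "int i = (- (u * q)) mod int N" unfolding i_def using assms(2) by simp
  have "[int i * a + s = - (u * q) * a + s] (mod int N)"
    unfolding i by (intro cong_add cong_scalar_right) (simp_all add: cong_def)
  moreover have "- (u * q) * a + s = int N * (v * q)"
    unfolding q uv[symmetric] by (simp add: algebra_simps)
  ultimately have "int N dvd int i * a + s"
    using cong_dvd_iff[of _ _ "int N"] by (metis cong_0_iff cong_mult_self_left cong_trans)
  then show thesis using that by blast
qed

locale unique_prime_order_subgroup = group +
  fixes p l :: nat
  assumes p: "Factorial_Ring.prime p"
    and ord_G: "order G = p ^ l"
    and unique: "\<And>a b. \<lbrakk>a \<in> carrier G; b \<in> carrier G; ord a = p; ord b = p\<rbrakk> \<Longrightarrow> b \<in> generate G {a}"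
begin

lemma fin: "finite (carrier G)"
  using ord_G p order_gt_0_iff_finite prime_gt_0_nat by (metis zero_less_power)

lemma ord_pos: "x \<in> carrier G \<Longrightarrow> ord x > 0"
  using ord_ge_1[OF fin] by (metis less_one not_le not_gr_zero)

lemma ord_power: "x \<in> carrier G \<Longrightarrow> \<exists>k. ord x = p ^ k"
  using ord_dvd_group_order ord_G p divides_primepow_nat by metis

lemma mem_generate_if_pow_eq_one:
  assumes x: "x \<in> carrier G" "x \<noteq> \<one>" and y: "y \<in> carrier G" "y [^] p = \<one>"
  shows "y \<in> generate G {x}"
proof (cases "y = \<one>")
  case True
  then show ?thesis by (simp add: generate.one)
next
  case False
  obtain k where k: "ord x = p ^ k" using ord_power x by blast
  with x have "k \<noteq> 0" using ord_eq_1[of x] by auto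
  then have pk: "p dvd ord x" "ord x div p ^ (k - 1) = p" "p ^ (k - 1) dvd ord x"
    using k p prime_gt_0_nat[OF p] by (cases k; simp)+
  have "ord (x [^] (p ^ (k - 1))) = p"
    using ord_pow[of x "p ^ (k - 1)"] x pk p by auto
  moreover have "ord y = p"
    using y False ord_eq_1 p pow_eq_id prime_nat_iff by metis
  ultimately have "y \<in> generate G {x [^] (p ^ (k - 1))}" using unique x y by simp
  moreover have "x [^] (p ^ (k - 1)) \<in> generate G {x}"
    using int_pow_in_generate[of x "int (p ^ (k - 1))"] x by (simp only: int_pow_int)
  ultimately show ?thesis using generate_singleton_mono x by blast
qed

text \<open>
  Otherwise some \<open>x\<^sup>i u\<close> has \<open>p\<close>-th power \<open>x\<^bsup>i (1 + t + \<dots>) + s\<^esup> = 1\<close>, so it lies in the only subgroup of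
  order \<open>p\<close>, hence in the group generated by \<open>x\<close>, and so does \<open>u\<close>.
\<close>

lemma no_pth_root_correction:
  fixes s t :: nat
  assumes x: "x \<in> carrier G" "x \<noteq> \<one>" and u: "u \<in> carrier G" "u \<notin> generate G {x}"
    and rel: "u \<otimes> x = x [^] t \<otimes> u" "u [^] p = x [^] s"
  shows "\<not> gcd (\<Sum>j<p. int t ^ j) (int (ord x)) dvd int s"
proof
  assume "gcd (\<Sum>j<p. int t ^ j) (int (ord x)) dvd int s"
  moreover have "ord x > 0" using ord_pos x by simp
  ultimately obtain i :: nat where "int (ord x) dvd int i * (\<Sum>j<p. int t ^ j) + int s"
    using nat_multiple_cong_if_gcd_dvd by blast
  then have "int (ord x) dvd int (i * (\<Sum>j<p. t ^ j) + s)" by simp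
  then have dvd: "ord x dvd i * (\<Sum>j<p. t ^ j) + s" by (simp only: int_dvd_int_iff)
  have "(x [^] i \<otimes> u) [^] p = x [^] (i * (\<Sum>j<p. t ^ j) + s)"
    using semi_commute_product_pow[OF x(1) u(1) rel(1)] rel(2) x by (simp add: nat_pow_mult)
  also have "\<dots> = \<one>" using dvd x by (simp add: pow_eq_id)
  finally have *: "x [^] i \<otimes> u \<in> generate G {x}"
    using mem_generate_if_pow_eq_one x u by simp
  have "x [^] (- int i) \<otimes> (x [^] i \<otimes> u) \<in> generate G {x}"
    by (rule generate.eng[OF int_pow_in_generate[OF x(1)] *])
  moreover have "x [^] (- int i) \<otimes> (x [^] i \<otimes> u) = u"
    using x u by (simp add: int_pow_neg int_pow_int flip: m_assoc)
  ultimately show False using u by simp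
qed

lemma obtain_pth_root:
  assumes "A \<subseteq> carrier G" "\<one> \<in> A" "v \<in> carrier G" "v \<notin> A"
  obtains j where "v [^] (p ^ j) \<notin> A" "v [^] (p ^ Suc j) \<in> A"
proof -
  have "v [^] (p ^ l) = \<one>" using pow_order_eq_1 assms ord_G by metis
  then have "v [^] (p ^ l) \<in> A" using assms by simp
  moreover have "v [^] (p ^ 0) \<notin> A" using assms by simp
  ultimately show thesis
    using that ex_least_nat_less[of "\<lambda>j. v [^] (p ^ j) \<in> A" l] by blast
qed

text \<open>
  An element \<open>x\<close> of largest order generates. Otherwise there is \<open>u\<close> outside \<open>\<langle>x\<rangle>\<close> with \<open>u\<^sup>p = x\<^sup>s\<close>. If
  \<open>p\<close> divides \<open>s\<close>, then \<open>u\<close> can be corrected by a power of \<open>x\<close> to have order \<open>p\<close>; if not, then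
  \<open>u\<^sup>p\<close> has the order of \<open>x\<close> and \<open>u\<close> has a larger one.
\<close>

lemma abelian_subgroup_cyclic:
  assumes A: "subgroup A G" and ab: "\<And>a b. a \<in> A \<Longrightarrow> b \<in> A \<Longrightarrow> a \<otimes> b = b \<otimes> a"
  obtains x where "x \<in> A" "A = generate G {x}"
proof -
  have sA: "A \<subseteq> carrier G" and one: "\<one> \<in> A" using A subgroup.subset subgroup.one_closed by blast+
  have finA: "finite A" using sA fin finite_subset by blast
  obtain x where x: "x \<in> A" and max: "\<And>y. y \<in> A \<Longrightarrow> ord y \<le> ord x"
  proof -
    have "Max (ord ` A) \<in> ord ` A" using finA one by (intro Max_in) auto
    then obtain x where "x \<in> A" "ord x = Max (ord ` A)" by auto
    then show thesis using that finA by simp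
  qed
  have xG: "x \<in> carrier G" using x sA by blast
  have "A \<subseteq> generate G {x}"
  proof (rule ccontr)
    assume "\<not> A \<subseteq> generate G {x}"
    then obtain y where y: "y \<in> A" "y \<notin> generate G {x}" by blast
    then have yG: "y \<in> carrier G" using sA by blast
    obtain j where j: "y [^] (p ^ j) \<notin> generate G {x}" "y [^] (p ^ Suc j) \<in> generate G {x}"
      using obtain_pth_root[of "generate G {x}" y] generate_incl[of "{x}"] xG yG y generate.one
      by blast
    define u where "u = y [^] (p ^ j)"
    have uA: "u \<in> A" unfolding u_def using subgroup_int_pow_closed[OF A y(1), of "int (p ^ j)"]
      by (simp only: int_pow_int)
    have uG: "u \<in> carrier G" using uA sA by blast
    have "u [^] p = y [^] (p ^ Suc j)" unfolding u_def using yG by (simp add: nat_pow_pow mult.commute)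
    then obtain s :: nat where s: "u [^] p = x [^] s"
      using j(2) generate_pow_on_finite_carrier[OF fin xG] by auto
    have x1: "x \<noteq> \<one>"
    proof
      assume "x = \<one>"
      then have "ord u \<le> 1" using max[OF uA] by simp
      moreover have "ord u \<noteq> 0" using ord_pos uG by simp
      ultimately have "u = \<one>" using ord_eq_1 uG by (metis le_neq_implies_less less_one)
      then show False using j(1) generate.one unfolding u_def by metis
    qed
    have "u \<otimes> x = x [^] (1::nat) \<otimes> u" using ab[OF uA x] xG by simp
    from no_pth_root_correction[OF xG x1 uG _ this s] j(1)
    have ngcd: "\<not> gcd (int p) (int (ord x)) dvd int s" unfolding u_def by simp
    then have "\<not> p dvd s"
      by (metis dvd_trans gcd_dvd1 int_dvd_int_iff)
    then have "coprime s p" using p prime_imp_coprime coprime_commute by metis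
    moreover obtain k where "ord x = p ^ k" using ord_power xG by blast
    ultimately have "coprime s (ord x)" by simp
    then have "ord (u [^] p) = ord x" using pow_ord_eq_ord_iff[OF fin xG] s by simp
    moreover have "ord (u [^] p) < ord u"
    proof -
      have "u \<noteq> \<one>" using j(1) generate.one unfolding u_def by metis
      moreover obtain k where k: "ord u = p ^ k" using ord_power uG by blast
      ultimately have "k \<noteq> 0" using ord_eq_1[OF uG] by auto
      then have "p dvd ord u" using k by (simp add: dvd_power)
      then have "ord (u [^] p) = ord u div p" using ord_pow uG p by (metis not_prime_0)
      then show ?thesis using ord_pos[OF uG] prime_gt_1_nat[OF p] by simp
    qed
    ultimately show False using max[OF uA] by simp
  qed
  then show thesis
    using that x generate_subgroup_incl[of "{x}" A] A by blast
qed

lemma normal_cyclic_conj: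
  assumes A: "A \<lhd> G" "A = generate G {x}" "x \<in> A" and u: "u \<in> carrier G"
  obtains t :: nat where "u \<otimes> x = x [^] t \<otimes> u"
proof -
  have xG: "x \<in> carrier G" using A normal_imp_subgroup subgroup.subset by blast
  have "u \<otimes> x \<otimes> inv u \<in> A" using normal.inv_op_closed2[OF A(1) u A(3)] .
  then obtain t :: nat where "u \<otimes> x \<otimes> inv u = x [^] t"
    using A(2) generate_pow_on_finite_carrier[OF fin xG] by auto
  then have "u \<otimes> x = x [^] t \<otimes> u" using xG u by (metis inv_solve_right m_closed nat_pow_closed)
  then show thesis by (rule that)
qed

text \<open>
  Since \<open>A\<close> is normal, \<open>u\<close> acts on it by \<open>x \<mapsto> x\<^sup>t\<close>, and \<open>inverting_exponent\<close> applies: \<open>u\<^sup>p\<close> lies in the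
  abelian group \<open>A\<close> and acts trivially, \<open>u\<close> does not because \<open>A\<close> contains the centralizer of \<open>x\<close>.
\<close>

lemma pth_root_inverts:
  assumes A: "A \<lhd> G" "A = generate G {x}" "x \<in> A"
    and self: "\<And>g. g \<in> carrier G \<Longrightarrow> g \<otimes> x = x \<otimes> g \<Longrightarrow> g \<in> A"
    and u: "u \<in> carrier G" "u \<notin> A" "u [^] p \<in> A"
    and ordx: "ord x = p ^ m"
  shows "p = 2 \<and> 2 \<le> m \<and> u \<otimes> x = inv x \<otimes> u \<and> u [^] (2::nat) = x [^] ((2::nat) ^ (m - 1))"
proof -
  have xG: "x \<in> carrier G" using A normal_imp_subgroup subgroup.subset by blast
  note gen = generate_pow_on_finite_carrier[OF fin xG]
  obtain s :: nat where s: "u [^] p = x [^] s" using u(3) A(2) gen by auto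
  obtain t :: nat where t: "u \<otimes> x = x [^] t \<otimes> u"
    using normal_cyclic_conj[OF A u(1)] by blast
  have x1: "x \<noteq> \<one>" using self[OF u(1)] u by auto
  have cong: "x [^] a = x [^] b \<longleftrightarrow> [int a = int b] (mod int p ^ m)" for a b :: nat
    using int_pow_eq[OF xG, of "int a" "int b"] ordx
    by (simp add: int_pow_int cong_iff_dvd_diff dvd_diff_commute)
  have tp: "[int t ^ p = 1] (mod int p ^ m)"
  proof -
    have "x [^] (t ^ p) \<otimes> x [^] s = x [^] (1::nat) \<otimes> x [^] s"
      using semi_commute_powers[OF xG u(1) t, of p 1] s nat_pow_comm[OF xG, of s 1] by simp
    then have "x [^] (t ^ p) = x [^] (1::nat)" using xG by (simp only: right_cancel nat_pow_closed)
    then show ?thesis using cong[of "t ^ p" 1] by simp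
  qed
  have t1: "\<not> [int t = 1] (mod int p ^ m)"
  proof
    assume "[int t = 1] (mod int p ^ m)"
    then have "x [^] t = x" using cong[of t 1] xG by simp
    then show False using self[OF u(1)] t u(2) by simp
  qed
  have st: "int p ^ m dvd int s * (int t - 1)"
  proof -
    have "x [^] s \<otimes> u = u \<otimes> x [^] s" unfolding s[symmetric] using nat_pow_comm[OF u(1), of p 1] u(1) by simp
    also have "\<dots> = x [^] (t * s) \<otimes> u"
      using semi_commute_powers[OF xG u(1) t, of 1 s] u(1) by simp
    finally have "x [^] (t * s) = x [^] s" using xG u(1) by (simp only: right_cancel nat_pow_closed)
    then have "[int (t * s) = int s] (mod int p ^ m)" using cong by blast
    then show ?thesis by (simp add: cong_iff_dvd_diff algebra_simps)
  qed
  have "\<not> gcd (\<Sum>j<p. int t ^ j) (int p ^ m) dvd int s"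
    using no_pth_root_correction[OF xG x1 u(1) _ t s] u(2) A(2) ordx by simp
  from inverting_exponent[OF p tp t1 st this]
  have p2: "p = 2" and m: "2 \<le> m" and tm: "[int t = -1] (mod int p ^ m)"
    and sm: "[int s = 2 ^ (m - 1)] (mod int p ^ m)" by auto
  have "x [^] t = inv x"
  proof -
    have "x [^] int t = x [^] (-1::int)"
    proof -
      have "- 1 - int t = - (int t + 1)" by simp
      moreover have "int (ord x) dvd int t + 1" using tm ordx by (simp add: cong_iff_dvd_diff)
      ultimately show ?thesis unfolding int_pow_eq[OF xG] by (metis dvd_minus_iff)
    qed
    then show ?thesis using xG by (simp add: int_pow_int int_pow_neg)
  qed
  moreover have "x [^] s = x [^] ((2::nat) ^ (m - 1))" using cong[of s "2 ^ (m - 1)"] sm by simp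
  ultimately show ?thesis using t s p2 m by simp
qed

lemma inverting_extension_generalized_quaternion:
  assumes x: "x \<in> carrier G" "ord x = 2 ^ m" "2 \<le> m"
    and u: "u \<in> carrier G" "u \<notin> generate G {x}" "u \<otimes> x = inv x \<otimes> u" "u [^] (2::nat) = x [^] ((2::nat) ^ (m - 1))"
    and cover: "carrier G = generate G {x} \<union> (\<lambda>a. a \<otimes> inv u) ` generate G {x}"
  shows "generalized_quaternion G (m + 1)"
proof -
  let ?A = "generate G {x}"
  have sub: "subgroup ?A G" using x by (simp add: generate_is_subgroup)
  have finA: "finite ?A" using fin cover by (metis finite_Un)
  have disj: "?A \<inter> (\<lambda>a. a \<otimes> inv u) ` ?A = {}"
  proof (rule ccontr)
    assume "?A \<inter> (\<lambda>a. a \<otimes> inv u) ` ?A \<noteq> {}"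
    then obtain a b where ab: "a \<in> ?A" "b \<in> ?A" "b = a \<otimes> inv u" by blast
    have "a \<in> carrier G" "b \<in> carrier G" using ab sub subgroup.subset by blast+
    then have "u = inv b \<otimes> a" using ab(3) u(1) by (simp add: inv_mult_group m_assoc)
    then show False
      using ab(1,2) u(2) subgroup.m_closed[OF sub] subgroup.m_inv_closed[OF sub] by metis
  qed
  have "card (carrier G) = card ?A + card ((\<lambda>a. a \<otimes> inv u) ` ?A)"
    using cover card_Un_disjoint[OF finA _ disj] finA by simp
  also have "card ((\<lambda>a. a \<otimes> inv u) ` ?A) = card ?A"
    using u(1) sub by (intro card_image inj_on_subset[OF inj_on_multc] subgroup.subset) auto
  also have "card ?A = 2 ^ m" using generate_pow_card x by simp
  finally have ord: "order G = 2 ^ (m + 1)" by (simp add: order_def)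
  have gen: "generate G {x, u} = carrier G"
  proof
    show "generate G {x, u} \<subseteq> carrier G" using x u by (intro generate_incl) auto
    have A: "?A \<subseteq> generate G {x, u}" by (intro mono_generate) auto
    have "inv u \<in> generate G {x, u}" by (intro generate.inv) auto
    then show "carrier G \<subseteq> generate G {x, u}"
      unfolding cover using A by (auto intro: generate.eng)
  qed
  have conj: "inv u \<otimes> x \<otimes> u = inv x"
  proof -
    have "u \<otimes> inv x = x \<otimes> u" using inverts_inv x(1) u(1,3) by blast
    then show ?thesis using x u(1) by (metis inv_closed inv_solve_left m_assoc m_closed)
  qed
  have "x [^] ((2::nat) ^ m) = \<one>" using x by (metis pow_ord_eq_1)
  then have "x [^] ((2::nat) ^ (m + 1 - 1)) = \<one>" by simp
  moreover have "u [^] (2::nat) = x [^] ((2::nat) ^ (m + 1 - 2))" using u(4) by simp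
  ultimately have "\<exists>x\<in>carrier G. \<exists>y\<in>carrier G. generate G {x, y} = carrier G
      \<and> x [^] ((2::nat) ^ (m + 1 - 1)) = \<one> \<and> y [^] (2::nat) = x [^] ((2::nat) ^ (m + 1 - 2))
      \<and> inv y \<otimes> x \<otimes> y = inv x"
    using x(1) u(1) gen conj by blast
  moreover have "3 \<le> m + 1" using x(3) by simp
  ultimately show ?thesis
    unfolding generalized_quaternion_def using is_group ord by blast
qed

text \<open>
  Some power of any element outside \<open>A\<close> is a \<open>p\<close>-th root of an element of \<open>A\<close> and therefore acts on
  \<open>A\<close> by inversion. Inversion not being a square, already the element itself has its square in \<open>A\<close>
  and inverts. The product of two inverting elements centralizes \<open>A\<close>, so \<open>A\<close> has index at most two.
\<close>

theorem cyclic_or_generalized_quaternion: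
  assumes nil: "nilpotent_group G"
  shows "cyclic_group G \<or> (\<exists>a. generalized_quaternion G a)"
proof -
  obtain A where A: "A \<lhd> G" and ab: "\<And>a b. a \<in> A \<Longrightarrow> b \<in> A \<Longrightarrow> a \<otimes> b = b \<otimes> a"
    and self: "\<And>g. g \<in> carrier G \<Longrightarrow> (\<And>a. a \<in> A \<Longrightarrow> g \<otimes> a = a \<otimes> g) \<Longrightarrow> g \<in> A"
    using self_centralizing_normal_abelian_subgroup[OF nil fin] by blast
  note subA = normal_imp_subgroup[OF A]
  obtain x where x: "x \<in> A" and Ax: "A = generate G {x}"
    using abelian_subgroup_cyclic[OF subA ab] by blast
  have sA: "A \<subseteq> carrier G" and one: "\<one> \<in> A"
    using subA subgroup.subset subgroup.one_closed by blast+
  have xG: "x \<in> carrier G" using x sA by blast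
  have selfx: "g \<in> A" if g: "g \<in> carrier G" "g \<otimes> x = x \<otimes> g" for g
  proof (rule self[OF g(1)])
    fix a assume "a \<in> A"
    then obtain n :: nat where "a = x [^] n"
      using Ax generate_pow_on_finite_carrier[OF fin xG] by auto
    then show "g \<otimes> a = a \<otimes> g"
      using group_commutes_pow[OF g(2)[symmetric] xG g(1)] by simp
  qed
  obtain m where m: "ord x = p ^ m" using ord_power xG by blast
  have inverts: "p = 2 \<and> 2 \<le> m \<and> g \<otimes> x = inv x \<otimes> g \<and> g [^] (2::nat) = x [^] ((2::nat) ^ (m - 1))"
    if "g \<in> carrier G" "g \<notin> A" "g [^] p \<in> A" for g
    using pth_root_inverts[OF A Ax x selfx that m] .
  show ?thesis
  proof (cases "A = carrier G")
    case True
    then have "carrier G = generate G {x}" using Ax by simp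
    then have "carrier G = range (\<lambda>n::int. x [^] n)"
      unfolding generate_pow[OF xG] by (simp add: full_SetCompr_eq)
    then show ?thesis using cyclic_group xG by blast
  next
    case False
    then obtain v where v: "v \<in> carrier G" "v \<notin> A" using sA by blast
    obtain j where j: "v [^] (p ^ j) \<notin> A" "v [^] (p ^ Suc j) \<in> A"
      using obtain_pth_root[OF sA one v] by blast
    define u where "u = v [^] (p ^ j)"
    have u: "u \<in> carrier G" "u \<notin> A" "u [^] p \<in> A"
      using v j unfolding u_def by (simp_all add: nat_pow_pow mult.commute)
    note invu = inverts[OF u]
    have p2: "p = 2" and m2: "2 \<le> m" using invu by auto
    (* Otherwise some h has h^2 outside A but h^4 in A; then h^2 acts by inversion. *)
    have sq: "g [^] (2::nat) \<in> A" if g: "g \<in> carrier G" for g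
    proof (rule ccontr)
      assume "g [^] (2::nat) \<notin> A"
      then obtain i where i: "(g [^] (2::nat)) [^] (p ^ i) \<notin> A" "(g [^] (2::nat)) [^] (p ^ Suc i) \<in> A"
        using obtain_pth_root[OF sA one, of "g [^] (2::nat)"] g by blast
      define h where "h = g [^] (p ^ i)"
      have h: "h \<in> carrier G" using g by (simp add: h_def)
      have "(h [^] (2::nat)) = (g [^] (2::nat)) [^] (p ^ i)"
        unfolding h_def using g by (simp add: nat_pow_pow mult.commute)
      moreover have "(h [^] (2::nat)) [^] p = (g [^] (2::nat)) [^] (p ^ Suc i)"
        unfolding h_def using g by (simp add: nat_pow_pow ac_simps)
      ultimately have "h [^] (2::nat) \<notin> A" "(h [^] (2::nat)) [^] p \<in> A"
        using i by (simp_all only: not_False_eq_True)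
      then have hinv: "h [^] (2::nat) \<otimes> x = inv x \<otimes> h [^] (2::nat)"
        using inverts[OF nat_pow_closed[OF h, of 2]] by blast
      obtain t :: nat where t: "h \<otimes> x = x [^] t \<otimes> h"
        using normal_cyclic_conj[OF A Ax x h] by blast
      have "4 dvd ord x" using m p2 m2 le_imp_power_dvd[of 2 m "2::nat"] by simp
      then show False using inversion_not_square[OF xG h t] hinv by blast
    qed
    have "g \<in> A \<union> (\<lambda>a. a \<otimes> inv u) ` A" if g: "g \<in> carrier G" for g
    proof (cases "g \<in> A")
      case False
      have ginv: "g \<otimes> x = inv x \<otimes> g" using inverts[OF g False] sq[OF g] p2 by simp
      have uinv: "u \<otimes> x = inv x \<otimes> u" using invu by simp
      have gx: "g \<otimes> inv x = x \<otimes> g" using inverts_inv[OF xG g ginv] .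
      have "(g \<otimes> u) \<otimes> x = g \<otimes> (u \<otimes> x)" using g u(1) xG by (simp add: m_assoc)
      also have "\<dots> = (g \<otimes> inv x) \<otimes> u" unfolding uinv using g u(1) xG by (simp add: m_assoc)
      also have "\<dots> = x \<otimes> (g \<otimes> u)" unfolding gx using g u(1) xG by (simp add: m_assoc)
      finally have "g \<otimes> u \<in> A" using selfx g u(1) by simp
      moreover have "g = (g \<otimes> u) \<otimes> inv u" using g u(1) by (simp add: m_assoc)
      ultimately show ?thesis by blast
    qed simp
    then have cover: "carrier G = A \<union> (\<lambda>a. a \<otimes> inv u) ` A" using sA u(1) by auto
    have "generalized_quaternion G (m + 1)"
      using inverting_extension_generalized_quaternion[of x m u] xG m m2 p2 u invu cover Ax by simp
    then show ?thesis by blast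
  qed
qed

end

section \<open>Separating the cyclic subgroups of a p-group\<close>

text \<open>
  Graph-theoretic data stated inside the group: each element of \<open>D\<close> is adjacent or equal to every
  element in the enhanced power graph, and outside \<open>D\<close> the set \<open>U\<close> is a nontrivial union of connected
  components.
\<close>

definition cyclic_separation :: "('a, 'b) monoid_scheme \<Rightarrow> 'a set \<Rightarrow> 'a set \<Rightarrow> bool" where
  "cyclic_separation G D U \<longleftrightarrow> D \<subseteq> carrier G \<and> D \<noteq> {} \<and>
     (\<forall>u\<in>D. \<forall>v\<in>carrier G. \<exists>w\<in>carrier G. u \<in> generate G {w} \<and> v \<in> generate G {w}) \<and>
     (\<forall>w\<in>carrier G. \<forall>u\<in>generate G {w} - D. \<forall>v\<in>generate G {w} - D. u \<in> U \<longleftrightarrow> v \<in> U) \<and>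
     (\<exists>u\<in>carrier G - D. u \<in> U) \<and> (\<exists>v\<in>carrier G - D. v \<notin> U)"

text \<open>
  There are \<open>a\<close> and \<open>b\<close> that generate different subgroups of order \<open>p\<close>. The separating set consists of
  the elements that have \<open>a\<close> among their powers: if a cyclic subgroup contains \<open>a\<close>, all its
  nontrivial elements are of this kind, but \<open>b\<close> is not.
\<close>

theorem noncyclic_nonquaternion_separation:
  fixes G (structure)
  assumes nil: "nilpotent_group G" and p: "Factorial_Ring.prime p" and ord: "order G = p ^ l"
    and "\<not> cyclic_group G" "\<nexists>a. generalized_quaternion G a"
  shows "\<exists>U. cyclic_separation G {\<one>} U"
proof -
  have G: "group G" using nil by (simp add: nilpotent_group_def)
  then interpret group G .
  have ordp: "\<exists>k. ord w = p ^ k" if "w \<in> carrier G" for w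
    using ord_dvd_group_order[OF that] ord p divides_primepow_nat by metis
  have "\<not> unique_prime_order_subgroup G p l"
    using unique_prime_order_subgroup.cyclic_or_generalized_quaternion[OF _ nil] assms(4,5) by blast
  then obtain a b where ab: "a \<in> carrier G" "b \<in> carrier G" "ord a = p" "ord b = p" "b \<notin> generate G {a}"
    unfolding unique_prime_order_subgroup_def unique_prime_order_subgroup_axioms_def
    using G p ord by blast
  have ap: "a [^] p = \<one>" and bp: "b [^] p = \<one>" using ab by (metis pow_ord_eq_1)+
  have a1: "a \<noteq> \<one>" "b \<noteq> \<one>" using ab p ord_id by (metis not_prime_1)+
  let ?X = "{u. a \<in> generate G {u}}"
  have step: "a \<in> generate G {v}"
    if "w \<in> carrier G" "u \<in> generate G {w}" "v \<in> generate G {w}" "v \<noteq> \<one>" "a \<in> generate G {u}"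
    for u v w
    using prime_order_mem_cyclic[OF p that(1) _ _ ap that(3,4)] ordp[OF that(1)]
      generate_singleton_mono[OF that(1,2)] that(5) by blast
  have "a \<notin> generate G {b}"
  proof
    assume "a \<in> generate G {b}"
    then have "b \<in> generate G {a}"
      using prime_order_mem_cyclic[OF p ab(2) _ _ bp _ a1(1), of 1] ab(4) generate.incl[of b "{b}" G] by simp
    then show False using ab(5) by blast
  qed
  moreover have "a \<in> generate G {a}" by (simp add: generate.incl)
  moreover have "\<exists>w\<in>carrier G. u \<in> generate G {w} \<and> v \<in> generate G {w}"
    if "u \<in> {\<one>}" "v \<in> carrier G" for u v
    using that by (auto intro!: bexI[of _ v] generate.one generate.incl)
  ultimately have "cyclic_separation G {\<one>} ?X"
    unfolding cyclic_separation_def using ab(1,2) a1 step by blast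
  then show ?thesis ..
qed

text \<open>
  Every element is \<open>c\<close> or \<open>c y\<close> with \<open>c\<close> in \<open>\<langle>x\<rangle>\<close>, and \<open>(c y)\<^sup>2 = c c\<^sup>-\<^sup>1 y\<^sup>2 = z\<close>, the involution of \<open>\<langle>x\<rangle>\<close>.
  The order of the group forces \<open>x\<close> to have order \<open>2\<^sup>a\<^sup>-\<^sup>1\<close>, at least 4, whence the centre is \<open>{1, z}\<close>. The
  separating set is \<open>\<langle>x\<rangle>\<close>.
\<close>

theorem generalized_quaternion_separation:
  fixes G (structure)
  assumes "generalized_quaternion G a"
  shows "card (group_center G) = 2" and "\<exists>U. cyclic_separation G (group_center G) U"
proof -
  have G: "group G" using assms by (simp add: generalized_quaternion_def)
  then interpret group G .
  obtain x y where a3: "a \<ge> 3" and ordG: "order G = 2 ^ a"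
    and x: "x \<in> carrier G" and y: "y \<in> carrier G" and gen: "generate G {x, y} = carrier G"
    and xpow: "x [^] ((2::nat) ^ (a - 1)) = \<one>" and ysq: "y [^] (2::nat) = x [^] ((2::nat) ^ (a - 2))"
    and conj: "inv y \<otimes> x \<otimes> y = inv x"
    using assms unfolding generalized_quaternion_def by blast
  define m where "m = a - 2"
  have m: "m \<ge> 1" "a = m + 2" using a3 by (auto simp: m_def)
  define z where "z = x [^] ((2::nat) ^ m)"
  have z: "z \<in> carrier G" using x by (simp add: z_def)
  have yy: "y \<otimes> y = z" using ysq y by (simp add: z_def m_def numeral_2_eq_2)
  have zz: "z \<otimes> z = \<one>" using xpow x m by (simp add: z_def nat_pow_mult mult_2)
  let ?X = "generate G {x}"
  have sub: "subgroup ?X G" using x by (simp add: generate_is_subgroup)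
  have XG: "?X \<subseteq> carrier G" using sub subgroup.subset by blast
  have zX: "z \<in> ?X" using int_pow_in_generate[OF x, of "int (2 ^ m)"] by (simp only: z_def int_pow_int)
  have yx: "y \<otimes> c = inv c \<otimes> y" if c: "c \<in> ?X" for c
  proof -
    have "inv y \<otimes> (x \<otimes> y) = inv x" using conj x y by (simp add: m_assoc)
    then have xy: "x \<otimes> y = y \<otimes> inv x" using x y by (metis inv_closed inv_solve_left m_closed)
    have "inv y \<otimes> x [^] (i::int) \<otimes> y = x [^] (- i)" for i
    proof -
      have "group_hom G G (\<lambda>g. inv y \<otimes> g \<otimes> y)"
      proof (intro group_hom.intro G group_hom_axioms.intro homI)
        fix g h assume gh: "g \<in> carrier G" "h \<in> carrier G"
        have "y \<otimes> (inv y \<otimes> t) = t" if "t \<in> carrier G" for t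
          using y that by (simp flip: m_assoc)
        then show "inv y \<otimes> (g \<otimes> h) \<otimes> y = inv y \<otimes> g \<otimes> y \<otimes> (inv y \<otimes> h \<otimes> y)"
          using gh y by (simp add: m_assoc)
      qed (use y in simp)
      from group_hom.hom_int_pow[OF this x, of i] show ?thesis
        using x unfolding conj by (simp add: int_pow_inv int_pow_neg)
    qed
    moreover obtain i :: int where i: "inv c = x [^] i"
      using subgroup.m_inv_closed[OF sub c] generate_pow[OF x] by auto
    moreover have cG: "c \<in> carrier G" using c XG by blast
    ultimately have "inv y \<otimes> (inv c \<otimes> y) = c"
      using x y by (metis int_pow_closed int_pow_neg inv_closed inv_inv m_assoc)
    then show ?thesis using cG y by (metis inv_closed inv_solve_left m_closed)
  qed
  have sq: "(c \<otimes> y) \<otimes> (d \<otimes> y) = (c \<otimes> inv d) \<otimes> z" if "c \<in> ?X" "d \<in> ?X" for c d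
  proof -
    have cd: "c \<in> carrier G" "d \<in> carrier G" using that XG by auto
    have "(c \<otimes> y) \<otimes> (d \<otimes> y) = c \<otimes> (y \<otimes> d) \<otimes> y" using cd y by (simp add: m_assoc)
    also have "\<dots> = (c \<otimes> inv d) \<otimes> (y \<otimes> y)" unfolding yx[OF that(2)] using cd y by (simp add: m_assoc)
    finally show ?thesis unfolding yy .
  qed
  have fin: "finite (carrier G)" using ordG order_gt_0_iff_finite by (metis zero_less_numeral zero_less_power)
  have cover: "carrier G = ?X \<union> (\<lambda>c. c \<otimes> y) ` ?X"
  proof
    have "subgroup (?X \<union> (\<lambda>c. c \<otimes> y) ` ?X) G"
    proof (rule subgroupI)
      show "?X \<union> (\<lambda>c. c \<otimes> y) ` ?X \<subseteq> carrier G" using XG y by auto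
      show "?X \<union> (\<lambda>c. c \<otimes> y) ` ?X \<noteq> {}" using zX by blast
    next
      fix g assume "g \<in> ?X \<union> (\<lambda>c. c \<otimes> y) ` ?X"
      then consider "g \<in> ?X" | c where "c \<in> ?X" "g = c \<otimes> y" by blast
      then show "inv g \<in> ?X \<union> (\<lambda>c. c \<otimes> y) ` ?X"
      proof cases
        case 1
        then show ?thesis using subgroup.m_inv_closed[OF sub] by blast
      next
        case 2
        have cG: "c \<in> carrier G" using 2 XG by blast
        have "(z \<otimes> c \<otimes> y) \<otimes> (c \<otimes> y) = \<one>"
          using sq[OF subgroup.m_closed[OF sub zX 2(1)] 2(1)] zz z cG by (simp add: m_assoc)
        then have "inv g = (z \<otimes> c) \<otimes> y" using 2 cG y z by (metis inv_equality m_closed)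
        then show ?thesis using subgroup.m_closed[OF sub zX 2(1)] by blast
      qed
    next
      fix g h assume "g \<in> ?X \<union> (\<lambda>c. c \<otimes> y) ` ?X" "h \<in> ?X \<union> (\<lambda>c. c \<otimes> y) ` ?X"
      then consider "g \<in> ?X" "h \<in> ?X" | d where "g \<in> ?X" "d \<in> ?X" "h = d \<otimes> y"
        | c where "c \<in> ?X" "g = c \<otimes> y" "h \<in> ?X" | c d where "c \<in> ?X" "g = c \<otimes> y" "d \<in> ?X" "h = d \<otimes> y"
        by blast
      then show "g \<otimes> h \<in> ?X \<union> (\<lambda>c. c \<otimes> y) ` ?X"
      proof cases
        case 1
        then show ?thesis using subgroup.m_closed[OF sub] by blast
      next
        case 2
        then have "g \<otimes> h = (g \<otimes> d) \<otimes> y" using XG y by (simp add: m_assoc subset_iff)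
        then show ?thesis using subgroup.m_closed[OF sub 2(1,2)] by blast
      next
        case 3
        then have "g \<otimes> h = c \<otimes> (y \<otimes> h)" using XG y by (simp add: m_assoc subset_iff)
        also have "\<dots> = (c \<otimes> inv h) \<otimes> y" unfolding yx[OF 3(3)] using 3 XG y by (simp add: m_assoc subset_iff)
        finally show ?thesis
          using subgroup.m_closed[OF sub 3(1) subgroup.m_inv_closed[OF sub 3(3)]] by blast
      next
        case 4
        then have "g \<otimes> h = (c \<otimes> inv d) \<otimes> z" using sq by simp
        then show ?thesis
          using subgroup.m_closed[OF sub subgroup.m_closed[OF sub 4(1) subgroup.m_inv_closed[OF sub 4(3)]] zX]
          by simp
      qed
    qed
    moreover have "{x, y} \<subseteq> ?X \<union> (\<lambda>c. c \<otimes> y) ` ?X"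
      using generate.incl[of x "{x}" G] subgroup.one_closed[OF sub] y by (auto intro: image_eqI[of _ _ \<one>])
    ultimately show "carrier G \<subseteq> ?X \<union> (\<lambda>c. c \<otimes> y) ` ?X"
      using generate_subgroup_incl gen by blast
    show "?X \<union> (\<lambda>c. c \<otimes> y) ` ?X \<subseteq> carrier G" using XG y by auto
  qed
  have cardX: "card ?X = ord x" using generate_pow_card[OF x] by simp
  have ordle: "ord x \<le> 2 ^ (m + 1)" using xpow x m pow_eq_id[OF x] by (auto intro: dvd_imp_le)
  have finX: "finite ?X" using fin XG finite_subset by blast
  have ynX: "y \<notin> ?X"
  proof
    assume "y \<in> ?X"
    then have "carrier G \<subseteq> ?X" using cover subgroup.m_closed[OF sub] by blast
    then have "order G \<le> ord x" unfolding order_def cardX[symmetric] using finX card_mono by blast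
    moreover have "order G = 4 * 2 ^ m" using ordG m by simp
    moreover have "ord x \<le> 2 * 2 ^ m" using ordle by simp
    moreover have "(2::nat) ^ m > 0" by simp
    ultimately show False by linarith
  qed
  have ordx: "ord x = 2 ^ (m + 1)"
  proof -
    have "order G \<le> card ?X + card ((\<lambda>c. c \<otimes> y) ` ?X)"
      unfolding order_def by (subst cover) (rule card_Un_le)
    also have "\<dots> \<le> ord x + ord x" using card_image_le[OF finX, of "\<lambda>c. c \<otimes> y"] cardX by simp
    finally show ?thesis using ordG ordle m by simp
  qed
  have ord4: "ord x \<ge> 4" using m ordx power_increasing[of 2 "m + 1" "2::nat"] by simp
  have z1: "z \<noteq> \<one>"
    unfolding z_def using pow_eq_id[OF x] ordx by (auto dest: dvd_imp_le)
  have nX: "w \<otimes> w = z" if w: "w \<in> carrier G" "w \<notin> ?X" for w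
  proof -
    obtain c where "c \<in> ?X" "w = c \<otimes> y" using w cover by blast
    moreover from this have "c \<otimes> inv c = \<one>" using XG by (intro r_inv) blast
    ultimately show ?thesis using sq[of c c] z by simp
  qed
  have x2: "x \<otimes> x \<noteq> \<one>"
  proof
    assume "x \<otimes> x = \<one>"
    then have "x [^] (2::nat) = \<one>" using x by (simp add: numeral_2_eq_2)
    then have "ord x dvd 2" using pow_eq_id[OF x] by blast
    then have "ord x \<le> 2" by (rule dvd_imp_le) simp
    then show False using ord4 by simp
  qed
  have Xcomm: "c \<otimes> d = d \<otimes> c" if cd: "c \<in> ?X" "d \<in> ?X" for c d
    by (rule generate_commute[OF _ _ cd]) (use x in simp_all)
  have zinv: "inv z = z" using zz z by (metis inv_equality)
  have center: "group_center G = {\<one>, z}"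
  proof
    show "{\<one>, z} \<subseteq> group_center G"
    proof -
      have "z \<otimes> g = g \<otimes> z" if g: "g \<in> carrier G" for g
      proof -
        from g cover consider "g \<in> ?X" | c where "c \<in> ?X" "g = c \<otimes> y" by blast
        then show ?thesis
        proof cases
          case 1
          then show ?thesis using Xcomm zX by blast
        next
          case 2
          have cG: "c \<in> carrier G" using 2 XG by blast
          have "z \<otimes> g = (z \<otimes> c) \<otimes> y" using 2 cG y z by (simp add: m_assoc)
          also have "\<dots> = c \<otimes> (z \<otimes> y)" unfolding Xcomm[OF zX 2(1)] using cG y z by (simp add: m_assoc)
          also have "z \<otimes> y = y \<otimes> z" using yx[OF zX] zinv by simp
          also have "c \<otimes> (y \<otimes> z) = g \<otimes> z" using 2 cG y z by (simp add: m_assoc)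
          finally show ?thesis .
        qed
      qed
      then have "z \<in> group_center G" unfolding group_center_def using z by blast
      moreover have "\<one> \<in> group_center G" by (simp add: group_center_def)
      ultimately show ?thesis by blast
    qed
    show "group_center G \<subseteq> {\<one>, z}"
    proof
      fix g assume "g \<in> group_center G"
      then have g: "g \<in> carrier G" and gc: "\<And>h. h \<in> carrier G \<Longrightarrow> g \<otimes> h = h \<otimes> g"
        unfolding group_center_def by blast+
      have "g \<in> ?X"
      proof (rule ccontr)
        assume "g \<notin> ?X"
        then obtain c where c: "c \<in> ?X" "g = c \<otimes> y" using g cover by blast
        have cG: "c \<in> carrier G" using c XG by blast
        have xX: "x \<in> ?X" by (simp add: generate.incl)
        have "c \<otimes> (x \<otimes> y) = (c \<otimes> x) \<otimes> y" using cG x y by (simp add: m_assoc)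
        also have "\<dots> = x \<otimes> g" unfolding Xcomm[OF c(1) xX] c(2) using cG x y by (simp add: m_assoc)
        also have "\<dots> = g \<otimes> x" by (rule gc[OF x, symmetric])
        also have "\<dots> = c \<otimes> (y \<otimes> x)" unfolding c(2) using cG x y by (simp add: m_assoc)
        also have "\<dots> = c \<otimes> (inv x \<otimes> y)" unfolding yx[OF xX] ..
        finally have "x = inv x" using cG x y by simp
        then show False using x2 x by (metis r_inv)
      qed
      then have "inv g \<otimes> y = g \<otimes> y" using gc[OF y] yx by metis
      then have "inv g = g" using g y by simp
      then have "g \<otimes> g = \<one>" using g by (metis r_inv)
      then have gg: "g [^] (2::nat) = \<one>" using g by (simp add: numeral_2_eq_2)
      show "g \<in> {\<one>, z}"
      proof (cases "g = \<one>")
        case False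
        have "g \<in> generate G {z}"
          using prime_order_mem_cyclic[OF two_is_prime_nat x ordx \<open>g \<in> ?X\<close> gg zX z1] .
        then obtain i :: nat where i: "g = z [^] i"
          using generate_pow_on_finite_carrier[OF fin z] by auto
        have "z [^] i \<in> {\<one>, z}" using z zz by (induction i) auto
        then show ?thesis using i by simp
      qed simp
    qed
  qed
  show "card (group_center G) = 2" unfolding center using z1 by auto
  have zv: "z \<in> generate G {v}" if v: "v \<in> carrier G" "v \<noteq> \<one>" for v
  proof (cases "v \<in> ?X")
    case True
    have "z [^] (2::nat) = \<one>" using zz z by (simp add: numeral_2_eq_2)
    then show ?thesis
      using prime_order_mem_cyclic[OF two_is_prime_nat x ordx zX _ True v(2)] by blast
  next
    case False
    have "v \<otimes> v \<in> generate G {v}" by (intro generate.eng generate.incl) auto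
    then show ?thesis using nX[OF v(1) False] by simp
  qed
  have dom: "\<exists>w\<in>carrier G. u \<in> generate G {w} \<and> v \<in> generate G {w}"
    if "u \<in> group_center G" "v \<in> carrier G" for u v
  proof (cases "v = \<one>")
    case True
    then have "u \<in> generate G {z}" "v \<in> generate G {z}"
      using that(1) generate.one[of G "{z}"] generate.incl[of z "{z}" G] unfolding center by auto
    then show ?thesis using z by blast
  next
    case False
    have "u \<in> generate G {v}" "v \<in> generate G {v}"
      using that(1) zv[OF that(2) False] generate.one[of G "{v}"] generate.incl[of v "{v}" G]
      unfolding center by auto
    then show ?thesis using that(2) by blast
  qed
  have out: "u \<notin> ?X" if w: "w \<in> carrier G" "w \<notin> ?X" and u: "u \<in> generate G {w}" "u \<notin> group_center G" for u w
  proof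
    assume uX: "u \<in> ?X"
    obtain n :: nat where n: "u = w [^] n"
      using u(1) generate_pow_on_finite_carrier[OF fin w(1)] by auto
    have "w [^] n \<in> {\<one>, z, w, w \<otimes> z}"
    proof (induction n)
      case (Suc n)
      have wz: "z \<otimes> w = w \<otimes> z" using nX[OF w] w(1) by (metis m_assoc)
      then have "w \<otimes> z \<otimes> w = w \<otimes> w \<otimes> z" using w(1) z by (simp add: m_assoc)
      then have wzw: "w \<otimes> z \<otimes> w = \<one>" using nX[OF w] zz by simp
      from Suc consider "w [^] n = \<one>" | "w [^] n = z" | "w [^] n = w" | "w [^] n = w \<otimes> z" by blast
      then show ?case by cases (simp_all add: wz wzw nX[OF w] w(1))
    qed simp
    then have "u = w \<or> u = w \<otimes> z" using n u(2) unfolding center by blast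
    then show False
    proof
      assume "u = w \<otimes> z"
      then have "w = u \<otimes> z" using w(1) z zz by (simp add: m_assoc)
      then show False using subgroup.m_closed[OF sub uX zX] w(2) by simp
    qed (use uX w in simp)
  qed
  have inv: "u \<in> ?X \<longleftrightarrow> v \<in> ?X"
    if "w \<in> carrier G" "u \<in> generate G {w} - group_center G" "v \<in> generate G {w} - group_center G" for u v w
  proof (cases "w \<in> ?X")
    case True
    then show ?thesis using that generate_singleton_mono[OF x True] by blast
  next
    case False
    then show ?thesis using that out by blast
  qed
  have "x \<notin> group_center G"
    unfolding center using x2 zz x by auto
  moreover have "x \<in> ?X" by (simp add: generate.incl)
  moreover have "y \<notin> group_center G"
    unfolding center using ynX zX subgroup.one_closed[OF sub] by auto
  moreover have "group_center G \<subseteq> carrier G" "group_center G \<noteq> {}" unfolding center using z by auto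
  ultimately have "cyclic_separation G (group_center G) ?X"
    unfolding cyclic_separation_def using dom inv x y ynX by blast
  then show "\<exists>U. cyclic_separation G (group_center G) U" ..
qed

section \<open>The enhanced power graph of a product with a cyclic factor\<close>

text \<open>
  A separation of \<open>A\<close> is pulled back along the projection \<open>\<pi>\<close> onto the \<open>A\<close>-component.
\<close>

theorem (in commuting_coprime_subgroups) unique_minimum_cut_set_product:
  assumes fin: "finite (carrier G)" and G: "carrier G = A <#> B"
    and B: "B = generate G {q}" "q \<in> B"
    and sep: "cyclic_separation (G\<lparr>carrier := A\<rparr>) D U"
  shows "minimum_cut_set (with_proj (enhanced_power_graph G)) S \<longleftrightarrow> S = D <#> B"
    and "vertex_connectivity (with_proj (enhanced_power_graph G)) = card D * card B"
proof -
  let ?E = "enhanced_power_graph G"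
  interpret E: pair_graph ?E using fin by (rule pair_graph_enhanced_power_graph)
  have gen: "generate (G\<lparr>carrier := A\<rparr>) {w} = generate G {w}" if "w \<in> A" for w
    using generate_consistent[OF _ subA] that by simp
  note sep' = sep[unfolded cyclic_separation_def, simplified]
  have D: "D \<subseteq> A" "D \<noteq> {}" using sep' by blast+
  have dom: "\<exists>w\<in>A. u \<in> generate G {w} \<and> v \<in> generate G {w}" if "u \<in> D" "v \<in> A" for u v
    using sep' that gen by metis
  have inv: "u \<in> U \<longleftrightarrow> v \<in> U"
    if "w \<in> A" "u \<in> generate G {w}" "u \<notin> D" "v \<in> generate G {w}" "v \<notin> D" for u v w
    using sep' that gen[OF that(1)] by (metis DiffI)
  obtain a b where a: "a \<in> A" "a \<notin> D" "a \<in> U" and b: "b \<in> A" "b \<notin> D" "b \<notin> U"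
    using sep' by blast
  have one: "\<one> \<in> B" using subB by (rule subgroup.one_closed)
  define \<pi> where "\<pi> g = (THE u. u \<in> A \<and> (\<exists>c\<in>B. g = u \<otimes> c))" for g
  have pi: "\<pi> (u \<otimes> c) = u" if "u \<in> A" "c \<in> B" for u c
    unfolding \<pi>_def using that decomposition_unique(1) by (intro the_equality) blast+
  have verts: "pverts ?E = A <#> B" using G by (simp add: enhanced_power_graph_def)
  have adj: "(u \<otimes> c, v \<otimes> d) \<in> parcs ?E \<longleftrightarrow>
      u \<otimes> c \<noteq> v \<otimes> d \<and> (\<exists>w\<in>A. u \<in> generate G {w} \<and> v \<in> generate G {w})"
    if "u \<in> A" "c \<in> B" "v \<in> A" "d \<in> B" for u c v d
    using that common_cyclic_iff[OF G B that] by (simp add: enhanced_power_graph_def)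
  have mem: "u \<otimes> c \<in> D <#> B \<longleftrightarrow> u \<in> D" if "u \<in> A" "c \<in> B" for u c
  proof
    assume "u \<otimes> c \<in> D <#> B"
    then obtain u' c' where "u' \<in> D" "c' \<in> B" "u \<otimes> c = u' \<otimes> c'" unfolding set_mult_def by blast
    then show "u \<in> D" using decomposition_unique(1)[of u c u' c'] that D by blast
  qed (use that in \<open>auto simp: set_mult_def\<close>)
  have elim: "\<exists>u c. u \<in> A \<and> c \<in> B \<and> g = u \<otimes> c" if "g \<in> pverts ?E" for g
    using that unfolding verts set_mult_def by blast
  note cut = E.unique_minimum_cut_set_dominating[of "D <#> B" "\<lambda>g. \<pi> g \<in> U" a b]
  have 1: "D <#> B \<subseteq> pverts ?E"
    unfolding verts using D by (intro mono_set_mult) auto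
  have 2: "D <#> B \<noteq> {}" using D one unfolding set_mult_def by blast
  have 3: "(g, h) \<in> parcs ?E"
    if g: "g \<in> D <#> B" and h: "h \<in> pverts ?E" and "g \<noteq> h" for g h
  proof -
    obtain u c where uc: "u \<in> D" "c \<in> B" "g = u \<otimes> c" using g unfolding set_mult_def by blast
    obtain v d where vd: "v \<in> A" "d \<in> B" "h = v \<otimes> d" using elim[of h] h by auto
    show ?thesis using adj[of u c v d] uc vd D dom[of u v] \<open>g \<noteq> h\<close> by auto
  qed
  have 4: "(\<pi> g \<in> U) = (\<pi> h \<in> U)"
    if arc: "(g, h) \<in> parcs ?E"
      and gh: "g \<in> pverts ?E - (D <#> B)" "h \<in> pverts ?E - (D <#> B)" for g h
  proof -
    obtain u c where uc: "u \<in> A" "c \<in> B" "g = u \<otimes> c" using elim[of g] gh by auto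
    obtain v d where vd: "v \<in> A" "d \<in> B" "h = v \<otimes> d" using elim[of h] gh by auto
    have D: "u \<notin> D" "v \<notin> D"
      using gh mem[OF uc(1,2)] mem[OF vd(1,2)] uc(3) vd(3) by auto
    obtain w where w: "w \<in> A" "u \<in> generate G {w}" "v \<in> generate G {w}"
      using arc adj[OF uc(1,2) vd(1,2)] uc(3) vd(3) by auto
    show ?thesis
      using inv[OF w(1,2) D(1) w(3) D(2)] unfolding uc(3) vd(3) pi[OF uc(1,2)] pi[OF vd(1,2)] .
  qed
  have AG: "a \<otimes> \<one> = a" "b \<otimes> \<one> = b" using a b by simp_all
  have 5: "a \<in> pverts ?E - (D <#> B)" "b \<in> pverts ?E - (D <#> B)"
    using mem[OF a(1) one] mem[OF b(1) one] a(1,2) b(1,2)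
    unfolding AG by (simp_all add: enhanced_power_graph_def)
  have 6: "(\<pi> a \<in> U) \<noteq> (\<pi> b \<in> U)"
    using pi[OF a(1) one] pi[OF b(1) one] a b unfolding AG by simp
  show "minimum_cut_set (with_proj ?E) S \<longleftrightarrow> S = D <#> B"
    by (rule cut(1)[OF 1 2 3 4 5 6])
  show "vertex_connectivity (with_proj ?E) = card D * card B"
    using cut(2)[OF 1 2 3 4 5 6] card_set_mult[OF D(1)] by simp
qed


section \<open>Nilpotent groups with one noncyclic Sylow subgroup\<close>

text \<open>
  The conjunction is what an induction on the list needs: adding a factor uses
  that the product so far is a subgroup, has coprime order, is cyclic, and commutes with the
  factors not yet used.
\<close>

lemma (in group) set_mult_list_commuting_coprime:
  assumes sub: "\<And>i. i \<in> I \<Longrightarrow> subgroup (P i) G"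
    and cop: "\<And>i j. i \<in> I \<Longrightarrow> j \<in> I \<Longrightarrow> i \<noteq> j \<Longrightarrow> coprime (card (P i)) (card (P j))"
    and comm: "\<And>i j a b. i \<in> I \<Longrightarrow> j \<in> I \<Longrightarrow> i \<noteq> j \<Longrightarrow> a \<in> P i \<Longrightarrow> b \<in> P j \<Longrightarrow> a \<otimes> b = b \<otimes> a"
    and js: "distinct js" "set js \<subseteq> I"
    and cyc: "\<And>i. i \<in> set js \<Longrightarrow> cyclic_group (G\<lparr>carrier := P i\<rparr>)"
  defines "Q \<equiv> set_mult_list G (map P js)"
  shows "subgroup Q G \<and> card Q = (\<Prod>i\<in>set js. card (P i)) \<and> (\<exists>q\<in>Q. Q = generate G {q}) \<and>
    (\<forall>i\<in>I - set js. \<forall>a\<in>P i. \<forall>b\<in>Q. a \<otimes> b = b \<otimes> a)"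
  using js cyc unfolding Q_def
proof (induction js)
  case Nil
  have "a \<otimes> \<one> = \<one> \<otimes> a" if "i \<in> I" "a \<in> P i" for i a
    using subgroup.subset[OF sub[OF that(1)]] that(2) by auto
  then show ?case
    using generate_one triv_subgroup by (auto simp: set_mult_list_def)
next
  case (Cons i js)
  define Q where "Q = set_mult_list G (map P js)"
  have IH: "subgroup Q G" "card Q = (\<Prod>i\<in>set js. card (P i))"
    "\<And>j a b. j \<in> I - set js \<Longrightarrow> a \<in> P j \<Longrightarrow> b \<in> Q \<Longrightarrow> a \<otimes> b = b \<otimes> a"
    and exq: "\<exists>q\<in>Q. Q = generate G {q}"
  proof -
    have "subgroup Q G \<and> card Q = (\<Prod>i\<in>set js. card (P i)) \<and> (\<exists>q\<in>Q. Q = generate G {q}) \<and>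
        (\<forall>i\<in>I - set js. \<forall>a\<in>P i. \<forall>b\<in>Q. a \<otimes> b = b \<otimes> a)"
      unfolding Q_def using Cons.prems by (intro Cons.IH) auto
    then show "subgroup Q G" "card Q = (\<Prod>i\<in>set js. card (P i))" "\<exists>q\<in>Q. Q = generate G {q}"
      "\<And>j a b. j \<in> I - set js \<Longrightarrow> a \<in> P j \<Longrightarrow> b \<in> Q \<Longrightarrow> a \<otimes> b = b \<otimes> a"
      by blast+
  qed
  from exq obtain q where q: "q \<in> Q" "Q = generate G {q}" by blast
  have i: "i \<in> I" "i \<notin> set js" using Cons.prems by auto
  have "cyclic_group (G\<lparr>carrier := P i\<rparr>)" using Cons.prems by simp
  then obtain a where a: "a \<in> P i" "P i = generate G {a}"
    using cyclic_subgroup_iff[OF sub[OF i(1)]] by blast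
  have cQ: "coprime (card (P i)) (card Q)"
    unfolding IH(2) using i Cons.prems(2) by (intro prod_coprime_right cop) auto
  interpret C: commuting_coprime_subgroups G "P i" Q
    by (intro commuting_coprime_subgroups.intro commuting_coprime_subgroups_axioms.intro
        is_group sub[OF i(1)] IH(1) cQ) (use IH(3) i in blast)
  have eq: "set_mult_list G (map P (i # js)) = P i <#> Q"
    by (simp add: set_mult_list_def Q_def)
  have "c \<otimes> b = b \<otimes> c" if j: "j \<in> I - set (i # js)" "c \<in> P j" and b: "b \<in> P i <#> Q" for j c b
  proof -
    obtain g h where gh: "g \<in> P i" "h \<in> Q" "b = g \<otimes> h" using b unfolding set_mult_def by blast
    have carr: "c \<in> carrier G" "g \<in> carrier G" "h \<in> carrier G"
      using subgroup.subset sub j i gh IH(1) by blast+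
    have "c \<otimes> b = (g \<otimes> c) \<otimes> h"
      using comm[of j i c g] j i gh carr by (simp add: m_assoc[symmetric])
    also have "\<dots> = b \<otimes> c"
      using IH(3)[of j c h] j gh carr by (simp add: m_assoc)
    finally show ?thesis .
  qed
  moreover have "card (P i <#> Q) = (\<Prod>i\<in>set (i # js). card (P i))"
    using C.card_set_mult[OF order_refl] IH(2) i by simp
  moreover have "a \<otimes> q \<in> P i <#> Q" using a q unfolding set_mult_def by blast
  then have "\<exists>q\<in>P i <#> Q. P i <#> Q = generate G {q}"
    using C.cyclic_set_mult[OF a(2,1) q(2,1)] by blast
  ultimately show ?case unfolding eq using C.subgroup_set_mult by blast
qed

lemma multiplicity_prod_distinct_primes:
  assumes "finite I" "inj_on p I" "\<And>i. i \<in> I \<Longrightarrow> Factorial_Ring.prime (p i :: nat)" "k \<in> I"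
  shows "multiplicity (p k) (\<Prod>i\<in>I. p i ^ l i) = l k"
proof -
  have "(\<Prod>i\<in>I. p i ^ l i) = (\<Prod>q\<in>p ` I. q ^ l (inv_into I p q))"
    using assms(2) by (subst prod.reindex) (auto intro!: prod.cong)
  then show ?thesis
    using multiplicity_prod_prime_powers[of "p ` I" "p k" "\<lambda>q. l (inv_into I p q)"] assms by auto
qed

theorem theorem5p6:
  fixes G :: "('a, 'b) monoid_scheme"
    and P :: "nat \<Rightarrow> 'a set" and p l :: "nat \<Rightarrow> nat" and n r k :: nat
  assumes "group G" and "finite (carrier G)"
    and "nilpotent_group G" and "\<not> cyclic_group G"
    and "r \<ge> 2"
    and "\<And>i. i \<in> {1..r} \<Longrightarrow> Factorial_Ring.prime (p i)"
    and "strict_mono_on {1..r} p"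
    and "\<And>i. i \<in> {1..r} \<Longrightarrow> l i \<ge> 1"
    and "order G = n" and "n = (\<Prod>i=1..r. p i ^ l i)"
    and "\<And>i. i \<in> {1..r} \<Longrightarrow> sylow_subgroup G (p i) (P i)"
    and "carrier G = set_mult_list G (map P [1..<Suc r])"
    and "k \<in> {1..r}"
    and "\<And>i. i \<in> {1..r} \<Longrightarrow> i \<noteq> k \<Longrightarrow> cyclic_group (G\<lparr>carrier := P i\<rparr>)"
    and "\<not> cyclic_group (G\<lparr>carrier := P k\<rparr>)"
  shows "((\<nexists>a. generalized_quaternion (G\<lparr>carrier := P k\<rparr>) a) \<longrightarrow>
           (\<forall>S. minimum_cut_set (with_proj (enhanced_power_graph G)) S \<longleftrightarrow>
                S = set_mult_list G (map P ([1..<k] @ [Suc k..<Suc r]))) \<and>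
           real (vertex_connectivity (with_proj (enhanced_power_graph G))) =
             real n / real (p k ^ l k))
       \<and> (\<forall>a. generalized_quaternion (G\<lparr>carrier := P k\<rparr>) a \<longrightarrow>
           k = 1 \<and> p 1 = 2 \<and> a = l 1 \<and>
           (\<forall>S. minimum_cut_set (with_proj (enhanced_power_graph G)) S \<longleftrightarrow>
                S = set_mult_list G
                      (group_center (G\<lparr>carrier := P k\<rparr>) # map P [2..<Suc r])) \<and>
           real (vertex_connectivity (with_proj (enhanced_power_graph G))) =
             real n / real (2 ^ (l 1 - 1)))"
proof -
  interpret group G by fact
  let ?I = "{1..r}" and ?js = "[1..<k] @ [Suc k..<Suc r]" and ?P = "G\<lparr>carrier := P k\<rparr>"
  define Q where "Q = set_mult_list G (map P ?js)"
  have inj: "inj_on p ?I" using assms(7) by (rule strict_mono_on_imp_inj_on)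
  have sub: "subgroup (P i) G" if "i \<in> ?I" for i
    using assms(11)[OF that] by (simp add: sylow_subgroup_def)
  have card: "card (P i) = p i ^ l i" if i: "i \<in> ?I" for i
  proof -
    have "card (P i) = p i ^ multiplicity (p i) (\<Prod>i=1..r. p i ^ l i)"
      using assms(11)[OF i] assms(9,10) by (simp add: sylow_subgroup_def)
    then show ?thesis
      using multiplicity_prod_distinct_primes[of ?I p i l] inj assms(6) i by simp
  qed
  have cop: "coprime (card (P i)) (card (P j))" if "i \<in> ?I" "j \<in> ?I" "i \<noteq> j" for i j
  proof -
    have "p i \<noteq> p j" using inj that by (auto dest: inj_onD)
    then have "coprime (p i) (p j)" using assms(6) that primes_coprime by blast
    then show ?thesis using card that by simp
  qed
  have comm: "a \<otimes>\<^bsub>G\<^esub> b = b \<otimes>\<^bsub>G\<^esub> a" if "i \<in> ?I" "j \<in> ?I" "i \<noteq> j" "a \<in> P i" "b \<in> P j" for i j a b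
    using nilpotent_coprime_commute[OF assms(3) _ _ subgroup_pow_card subgroup_pow_card cop]
      sub subgroup.subset that by blast
  have js: "distinct ?js" "set ?js = ?I - {k}" using assms(13) by auto
  have jsI: "set ?js \<subseteq> ?I" and k: "k \<in> ?I - set ?js" using js(2) assms(13) by blast+
  have cyc: "cyclic_group (G\<lparr>carrier := P i\<rparr>)" if "i \<in> set ?js" for i
    using that assms(14) unfolding js(2) by blast
  have L: "subgroup Q G \<and> card Q = (\<Prod>i\<in>set ?js. card (P i)) \<and> (\<exists>q\<in>Q. Q = generate G {q}) \<and>
      (\<forall>i\<in>?I - set ?js. \<forall>a\<in>P i. \<forall>b\<in>Q. a \<otimes>\<^bsub>G\<^esub> b = b \<otimes>\<^bsub>G\<^esub> a)"
    unfolding Q_def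
  proof (rule set_mult_list_commuting_coprime)
    show "a \<otimes>\<^bsub>G\<^esub> b = b \<otimes>\<^bsub>G\<^esub> a" if "i \<in> ?I" "j \<in> ?I" "i \<noteq> j" "a \<in> P i" "b \<in> P j" for i j a b
      using that by (rule comm)
  qed (fact sub cop js(1) jsI cyc)+
  have Q: "subgroup Q G" "card Q = (\<Prod>i\<in>?I - {k}. card (P i))"
    using conjunct1[OF L] conjunct1[OF conjunct2[OF L]] by (simp_all only: js(2))
  obtain q where q: "q \<in> Q" "Q = generate G {q}"
    using conjunct1[OF conjunct2[OF conjunct2[OF L]]] by blast
  have commQ: "a \<otimes>\<^bsub>G\<^esub> b = b \<otimes>\<^bsub>G\<^esub> a" if "a \<in> P k" "b \<in> Q" for a b
    using conjunct2[OF conjunct2[OF conjunct2[OF L]]] k that by blast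
  have copQ: "coprime (card (P k)) (card Q)"
    unfolding Q(2) using assms(13) by (intro prod_coprime_right cop) auto
  interpret C: commuting_coprime_subgroups G "P k" Q
    by (intro commuting_coprime_subgroups.intro commuting_coprime_subgroups_axioms.intro
        is_group sub[OF assms(13)] Q(1) copQ commQ)
  have "(\<Prod>i\<in>?I. card (P i)) = n"
    unfolding assms(10) by (intro prod.cong card) auto
  then have nPQ: "n = card (P k) * card Q"
    unfolding Q(2) using assms(13) by (subst prod.remove[of _ k, symmetric]) auto
  have G: "carrier G = P k <#>\<^bsub>G\<^esub> Q"
  proof (rule card_subset_eq[symmetric, OF assms(2) subgroup.subset[OF C.subgroup_set_mult]])
    show "card (P k <#>\<^bsub>G\<^esub> Q) = card (carrier G)"
      using C.card_set_mult[OF order_refl] nPQ assms(9) by (simp add: order_def)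
  qed
  note cut = C.unique_minimum_cut_set_product[OF assms(2) G q(2,1)]
  have nilP: "nilpotent_group ?P" using nilpotent_subgroup[OF assms(3) sub[OF assms(13)]] .
  have ordP: "order ?P = p k ^ l k" using card[OF assms(13)] by (simp add: order_def)
  have ppos: "p k ^ l k > 0" using assms(6,13) by (simp add: prime_gt_0_nat)
  show ?thesis
  proof (intro conjI impI)
    assume "\<nexists>a. generalized_quaternion ?P a"
    then obtain U where "cyclic_separation ?P {\<one>\<^bsub>G\<^esub>} U"
      using noncyclic_nonquaternion_separation[OF nilP assms(6)[OF assms(13)] ordP assms(15)] by auto
    note cut = cut[OF this]
    have "{\<one>\<^bsub>G\<^esub>} <#>\<^bsub>G\<^esub> Q = Q" using lcos_mult_one[of Q] Q(1) subgroup.subset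
      by (metis l_coset_eq_set_mult)
    then show "\<forall>S. minimum_cut_set (with_proj (enhanced_power_graph G)) S \<longleftrightarrow>
        S = set_mult_list G (map P ?js)"
      using cut(1) by (simp add: Q_def)
    show "real (vertex_connectivity (with_proj (enhanced_power_graph G))) = real n / real (p k ^ l k)"
      unfolding cut(2) nPQ card[OF assms(13)] using ppos by simp
  next
    show "\<forall>a. generalized_quaternion ?P a \<longrightarrow> k = 1 \<and> p 1 = 2 \<and> a = l 1 \<and>
        (\<forall>S. minimum_cut_set (with_proj (enhanced_power_graph G)) S \<longleftrightarrow>
          S = set_mult_list G (group_center ?P # map P [2..<Suc r])) \<and>
        real (vertex_connectivity (with_proj (enhanced_power_graph G))) = real n / real (2 ^ (l 1 - 1))"
    proof (intro allI impI)
      fix a assume gq: "generalized_quaternion ?P a"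
      have "a \<ge> 3" "p k ^ l k = 2 ^ a" using gq ordP by (auto simp: generalized_quaternion_def)
      have pk: "p k = 2"
        using prime_power_eq_imp_eq[OF assms(6)[OF assms(13)] two_is_prime_nat _ \<open>p k ^ l k = 2 ^ a\<close>]
          assms(8)[OF assms(13)] by simp
      then have a: "a = l k" using \<open>p k ^ l k = 2 ^ a\<close> by simp
      have k1: "k = 1"
      proof (rule ccontr)
        assume "k \<noteq> 1"
        then have "p 1 < p k" using assms(7,13) by (auto simp: strict_mono_on_def)
        moreover have "p 1 \<ge> 2" using assms(6)[of 1] assms(13) by (simp add: prime_ge_2_nat)
        ultimately show False using pk by simp
      qed
      have "?js = [2..<Suc r]" using k1 by (simp add: numeral_2_eq_2)
      then have Q1: "set_mult_list G (group_center ?P # map P [2..<Suc r]) = group_center ?P <#>\<^bsub>G\<^esub> Q"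
        unfolding Q_def by (simp add: set_mult_list_def)
      obtain U where "cyclic_separation ?P (group_center ?P) U"
        using generalized_quaternion_separation(2)[OF gq] by blast
      note cut = cut[OF this]
      have "l k = Suc (l 1 - 1)" using a \<open>a \<ge> 3\<close> k1 by simp
      then have "real n = real (2 * card Q) * real (2 ^ (l 1 - 1))"
        unfolding nPQ card[OF assms(13)] pk by (simp only: power_Suc) simp
      then have "real (vertex_connectivity (with_proj (enhanced_power_graph G))) = real n / real (2 ^ (l 1 - 1))"
        unfolding cut(2) generalized_quaternion_separation(1)[OF gq] by simp
      then show "k = 1 \<and> p 1 = 2 \<and> a = l 1 \<and>
          (\<forall>S. minimum_cut_set (with_proj (enhanced_power_graph G)) S \<longleftrightarrow>
            S = set_mult_list G (group_center ?P # map P [2..<Suc r])) \<and>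
          real (vertex_connectivity (with_proj (enhanced_power_graph G))) = real n / real (2 ^ (l 1 - 1))"
        using k1 pk a cut(1) Q1 by simp
    qed
  qed
qed

end
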